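(* Let $q,y_1,y_2$ be formal variables. Then, as formal series, $$\prod_{m>0}\frac{1}{(1-q^my_1)}\frac{1}{(1-q^my_2)}\frac{1}{(1-q^my_1y_2)}\frac{1}{(1-q^my_1y_2^2)} =\sum_{r_1^{(\bullet)}}\ \sum_{r_2^{(\bullet)}}\frac{q^{\sum_{s\ge 1}(r_1^{(s)})^2}}{\prod_{s\ge1}(q)_{r_1^{(s)}-r_1^{(s+1)}}}\cdot\frac{q^{\sum_{s\ge1}(r_2^{(s)})^2-\sum_{s\ge1}r_1^{(s)}\left(r_2^{(2s-1)}+r_2^{(2s)}\right)}}{\prod_{s\ge1}(q)_{r_2^{(s)}-r_2^{(s+1)}}}\;y_1^{r_1}y_2^{r_2},$$ where $r_1^{(\bullet)}=(r_1^{(1)}\ge r_1^{(2)}\ge\cdots)$ and $r_2^{(\bullet)}=(r_2^{(1)}\ge r_2^{(2)}\ge\cdots)$ each run independently over all nonincreasing sequences of nonnegative integers with only finitely many nonzero terms, and $r_i=\sum_{s\ge1}r_i^{(s)}$ for $i=1,2$.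
   Context: For an integer $r\ge 1$, $(q)_r=(1-q)(1-q^2)\cdots(1-q^r)$, and $(q)_0=1$. Both sides are regarded as formal power series in $y_1,y_2$ whose coefficients are formal series in $q$; for fixed $(r_1,r_2)$ only finitely many pairs of sequences contribute to the right-hand side. *)

theory Defs
  imports "HOL-Computational_Algebra.Computational_Algebra"
begin

text \<open>
  A series in \<open>y\<^sub>1\<close>, \<open>y\<^sub>2\<close> over a coefficient ring is a nested power series: the outer
  variable is \<open>y\<^sub>1\<close>, the inner one is \<open>y\<^sub>2\<close>, so \<open>F $ a $ b\<close> is the coefficient of
  \<open>y\<^sub>1^a y\<^sub>2^b\<close>. The coefficients are Laurent series in \<open>q\<close>, because the exponent of \<open>q\<close>
  in the summand is written with a minus sign.
\<close>

definition coef :: "'a::field fls \<Rightarrow> 'a fls fps fps" where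
  "coef c = fps_const (fps_const c)"

definition Y1 :: "'a::field fls fps fps" where
  "Y1 = fps_X"

definition Y2 :: "'a::field fls fps fps" where
  "Y2 = fps_const fps_X"

definition qfac :: "nat \<Rightarrow> 'a::field fls" where
  "qfac r = (\<Prod>i=1..r. 1 - fls_X ^ i)"

text \<open>
  Convergence is taken separately for each coefficient of \<open>y\<^sub>1^a y\<^sub>2^b\<close>, in the \<open>q\<close>-adic metric
  of \<^typ>\<open>'a::field fls\<close>. The library metric on the outer type
  would be the wrong one here: it treats the coefficients as discrete, and infinite products
  of factors such as \<open>1 - q^m y\<^sub>1\<close> diverge in it.
\<close>

definition has_formal_prod ::
    "(nat \<Rightarrow> 'a::field fls fps fps) \<Rightarrow> 'a fls fps fps \<Rightarrow> bool" where
  "has_formal_prod f F \<longleftrightarrow>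
     (\<forall>a b. (\<lambda>N. (\<Prod>m=1..N. f m) $ a $ b) \<longlonglongrightarrow> F $ a $ b)"

definition has_formal_sum ::
    "('i \<Rightarrow> 'a::field fls fps fps) \<Rightarrow> 'i set \<Rightarrow> 'a fls fps fps \<Rightarrow> bool" where
  "has_formal_sum t I F \<longleftrightarrow>
     (\<forall>a b. finite {i\<in>I. t i $ a $ b \<noteq> 0} \<and>
            F $ a $ b = (\<Sum>i | i \<in> I \<and> t i $ a $ b \<noteq> 0. t i $ a $ b))"

lemma has_formal_prod_unique:
  assumes "has_formal_prod f F" "has_formal_prod f G"
  shows "F = G"
  using assms unfolding has_formal_prod_def
  by (intro fps_ext) (blast intro: LIMSEQ_unique)

lemma has_formal_sum_unique:
  assumes "has_formal_sum t I F" "has_formal_sum t I G"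
  shows "F = G"
  using assms unfolding has_formal_sum_def
  by (intro fps_ext) simp

text \<open>
  The library states that \<^const>\<open>inverse\<close> inverts a power series only for coefficients in a
  division ring; in the nested ring it does so for series with nonzero constant term.
\<close>

lemma mult_inverse_nested:
  fixes f :: "'a::field fls fps fps"
  assumes "f $ 0 $ 0 \<noteq> 0"
  shows "f * inverse f = 1"
proof -
  have "f $ 0 * inverse (f $ 0) = 1"
    using assms by (rule inverse_mult_eq_1')
  then show ?thesis
    by (simp add: fps_inverse_def fps_right_inverse)
qed

text \<open>
  Sequences are indexed from \<open>0\<close>, so \<open>r s\<close> stands for \<open>r^(s+1)\<close>. In particular
  \<open>r\<^sub>2^(2s-1) + r\<^sub>2^(2s)\<close> for \<open>s \<ge> 1\<close> becomes \<open>r\<^sub>2 (2s) + r\<^sub>2 (2s+1)\<close> for \<open>s \<ge> 0\<close>.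
  All sums and products over \<open>s\<close> are restricted to the support of the sequence, outside of
  which the terms are \<open>0\<close> and the factors are \<open>(q)\<^sub>0 = 1\<close>.
\<close>

definition supp :: "(nat \<Rightarrow> nat) \<Rightarrow> nat set" where
  "supp r = {s. r s \<noteq> 0}"

definition color_seqs :: "(nat \<Rightarrow> nat) set" where
  "color_seqs = {r. decseq r \<and> finite (supp r)}"

definition sq_sum :: "(nat \<Rightarrow> nat) \<Rightarrow> nat" where
  "sq_sum r = (\<Sum>s\<in>supp r. (r s)\<^sup>2)"

definition mixed_sum :: "(nat \<Rightarrow> nat) \<Rightarrow> (nat \<Rightarrow> nat) \<Rightarrow> nat" where
  "mixed_sum r1 r2 = (\<Sum>s\<in>supp r1. r1 s * (r2 (2 * s) + r2 (2 * s + 1)))"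

definition seq_total :: "(nat \<Rightarrow> nat) \<Rightarrow> nat" where
  "seq_total r = (\<Sum>s\<in>supp r. r s)"

definition qfac_diffs :: "(nat \<Rightarrow> nat) \<Rightarrow> 'a::field fls" where
  "qfac_diffs r = (\<Prod>s\<in>supp r. qfac (r s - r (Suc s)))"

end

theory Submission
  imports Defs
begin

text \<open>
Write \<open>(qy)\<^sub>n = (1 - qy) \<dots> (1 - q\<^sup>n y)\<close>, \<open>u = y\<^sub>1 y\<^sub>2\<close> and \<open>w = y\<^sub>1 y\<^sub>2\<^sup>2\<close>. The right-hand side is a sum over
columns, so it is natural to cut it off and to build it up one column at a time. Let \<open>F(m, n)\<close> be
the sum over all pairs of sequences, in which the summand carries the extra factor
\<open>1 / ((q)\<^sub>m\<^sub>-\<^sub>a (q)\<^sub>n\<^sub>-\<^sub>b)\<close>, where \<open>a\<close> and \<open>b\<close> are the first entries of \<open>r\<^sub>1\<close> and \<open>r\<^sub>2\<close> (the summand is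
dropped if \<open>a > m\<close> or \<open>b > n\<close>). Removing one entry of \<open>r\<^sub>1\<close> and two entries of \<open>r\<^sub>2\<close> gives

  \<open>F(m, n) = \<Sum> q\<^bsup>a\<^sup>2 + b\<^sup>2 + c\<^sup>2 - a(b + c)\<^esup> y\<^sub>1\<^sup>a y\<^sub>2\<^bsup>b + c\<^esup> / ((q)\<^sub>m\<^sub>-\<^sub>a (q)\<^sub>n\<^sub>-\<^sub>b (q)\<^sub>b\<^sub>-\<^sub>c) F(a, c)\<close>,

the sum being over \<open>a \<le> m\<close> and \<open>c \<le> b \<le> n\<close>. Because every index \<open>(a, b, c) \<noteq> 0\<close> raises the degree in \<open>y\<^sub>1\<close>
and \<open>y\<^sub>2\<close>, this recursion together with \<open>F(0, 0) = 1\<close> determines \<open>F\<close>.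

The point of the proof is that the recursion has an explicit solution, the double sum

  \<open>F(m, n) = 1/(qy\<^sub>2)\<^sub>n \<Sum>\<^bsub>k \<le> b\<^esub> q\<^bsup>b\<^sup>2 - bk + k\<^sup>2\<^esup> u\<^sup>b y\<^sub>2\<^sup>k / ((q)\<^sub>n\<^sub>-\<^sub>b (q)\<^sub>m\<^sub>-\<^sub>b (q)\<^sub>b\<^sub>-\<^sub>k (q)\<^sub>k (qy\<^sub>1)\<^sub>m\<^sub>-\<^sub>k (qu)\<^sub>b (qw)\<^sub>k)\<close>.

That it satisfies the recursion (\<open>closed_sum_recursion\<close>) follows by summing over \<open>c\<close>, \<open>b\<close>, \<open>a\<close> in
turn. Each summation is an instance of one identity, \<open>durfee_identity\<close>, whose right-hand side is
symmetric in its two parameters; the three instances in use are \<open>column_sum\<close>, \<open>column_sum_dual\<close>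
and \<open>column_sum_flip\<close>.

The infinite sum and the infinite product are both recovered for \<open>m = n = N \<rightarrow> \<infinity>\<close>. On the one hand
\<open>(q)\<^sub>N\<^sup>2 F(N, N)\<close> tends coefficientwise to the full sum, since \<open>(q)\<^sub>N / (q)\<^sub>N\<^sub>-\<^sub>a \<rightarrow> 1\<close> (\<open>trunc_sum_limit\<close>).
On the other hand two further applications of \<open>column_sum\<close> expand the finite product
\<open>1 / ((qy\<^sub>1)\<^sub>N (qy\<^sub>2)\<^sub>N (qu)\<^sub>N (qw)\<^sub>N)\<close> into a double sum of the same shape, which differs from the one for
\<open>(q)\<^sub>N\<^sup>2 F(N, N)\<close> termwise by factors tending to \<open>1\<close> (\<open>product_minus_closed_sum\<close>).

The \<open>q\<close>-identities are proved in an arbitrary field; they are applied in the fraction field of the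
ring of formal series, and the limits are controlled by the subring of series whose
coefficients have no pole at \<open>q = 0\<close>.
\<close>

section \<open>Gaussian binomials and a Durfee-type identity\<close>

lemma sum_rotate:
  "(\<Sum>a\<in>A. \<Sum>b\<in>B. \<Sum>c\<in>C. f a b c) = (\<Sum>b\<in>B. \<Sum>c\<in>C. \<Sum>a\<in>A. f a b c)"
  by (subst sum.swap, rule sum.cong[OF refl], rule sum.swap)

text \<open>
All \<open>q\<close>-identities are between finite sums. They involve negative powers of \<open>q\<close> and the denominators
\<open>(q)\<^sub>n\<close>, hence the two hypotheses.
\<close>

locale generic_base =
  fixes q :: "'k::field"
  assumes q_nonzero: "q \<noteq> 0"
    and q_not_root_of_unity: "n > 0 \<Longrightarrow> q ^ n \<noteq> 1"
begin

text \<open>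
This is \<open>(qy)\<^sub>n\<close>: the factor \<open>1 - y\<close> is left out. In particular \<open>poch 1 n\<close> is \<open>(q)\<^sub>n\<close>.
\<close>

definition poch :: "'k \<Rightarrow> nat \<Rightarrow> 'k" where
  "poch y n = (\<Prod>i=1..n. 1 - q ^ i * y)"

text \<open>
Gaussian binomial coefficients. The Pascal rule with the power of \<open>q\<close> on the second summand is the one
that drives the induction on \<open>n\<close> in the proof of \<open>durfee_identity\<close>.
\<close>

fun qbin :: "nat \<Rightarrow> nat \<Rightarrow> 'k" where
  "qbin n 0 = 1"
| "qbin 0 (Suc j) = 0"
| "qbin (Suc n) (Suc j) = qbin n (Suc j) + q ^ (n - j) * qbin n j"

text \<open>
The reciprocal of \<open>(q)\<^sub>n\<^sub>-\<^sub>k\<close>, with the convention that it vanishes for \<open>k > n\<close>. Thanks to it, nested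
sums with interlacing bounds can all be taken over one range \<open>{..M}\<close> and be interchanged freely.
\<close>

definition rq :: "nat \<Rightarrow> nat \<Rightarrow> 'k" where
  "rq n k = (if k \<le> n then 1 / poch 1 (n - k) else 0)"

text \<open>
Negative powers of \<open>q\<close> are included because \<open>column_sum_dual\<close> applies \<open>durfee_identity\<close> at
\<open>q\<^sup>-\<^sup>d y\<close>.
\<close>

definition generic :: "'k \<Rightarrow> bool" where
  "generic y \<longleftrightarrow> (\<forall>i. q powi i * y \<noteq> 1)"

lemma poch_0 [simp]: "poch y 0 = 1"
  by (simp add: poch_def)

lemma poch_Suc: "poch y (Suc n) = poch y n * (1 - q ^ Suc n * y)"
  by (simp add: poch_def)

lemma poch_add: "poch y (m + n) = poch y m * poch (q ^ m * y) n"
  by (induction n) (simp_all add: poch_Suc power_add algebra_simps)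

lemma poch_Suc_shift: "poch y (Suc n) = (1 - q * y) * poch (q * y) n"
  using poch_add[of y 1 n] by (simp add: poch_Suc)

lemma poch_1_nonzero [simp]: "poch 1 n \<noteq> 0"
  using q_not_root_of_unity by (auto simp: poch_def)

lemma generic_shift: "generic y \<Longrightarrow> generic (q powi d * y)"
  unfolding generic_def by (metis mult.assoc power_int_add q_nonzero)

lemma generic_shift_nat: "generic y \<Longrightarrow> generic (q ^ d * y)"
  using generic_shift[of y "int d"] by simp

lemma generic_factor: "generic y \<Longrightarrow> 1 - q ^ i * y \<noteq> 0"
  unfolding generic_def by (metis eq_iff_diff_eq_0 power_int_of_nat)

lemma poch_nonzero: "generic y \<Longrightarrow> poch y n \<noteq> 0"
  using generic_factor by (simp add: poch_def)

lemma qbin_eq_0: "n < j \<Longrightarrow> qbin n j = 0"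
  by (induction n j rule: qbin.induct) auto

text \<open>
Both sides are \<open>1 - q\<^sup>n\<close> times the same Gaussian binomial of \<open>n - 1\<close>.
\<close>

lemma qbin_absorb: "(1 - q ^ Suc j) * qbin n (Suc j) = (1 - q ^ (n - j)) * qbin n j"
proof (induction n arbitrary: j)
  case 0
  then show ?case by (cases j) auto
next
  case (Suc n)
  show ?case
  proof (cases j)
    case 0
    have "(1 - q) * qbin n (Suc 0) = 1 - q ^ n" using Suc.IH[of 0] by simp
    then have "(1 - q) * (qbin n (Suc 0) + q ^ n) = 1 - q * q ^ n" by (simp add: ring_distribs)
    with 0 show ?thesis by simp
  next
    case (Suc i)
    show ?thesis
    proof (cases "i < n")
      case True
      have e: "q ^ (n - i) = q * q ^ (n - Suc i)" "q ^ Suc n = q ^ Suc i * q ^ (n - i)"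
        using True by (simp_all flip: power_Suc power_add add: Suc_diff_Suc)
      have "(1 - q ^ Suc j) * qbin (Suc n) (Suc j)
          = (1 - q ^ (n - Suc i)) * qbin n (Suc i)
            + (1 - q ^ Suc (Suc i)) * q ^ (n - Suc i) * qbin n (Suc i)"
        by (simp only: Suc qbin.simps distrib_left Suc.IH[of "Suc i"] mult.assoc)
      also have "\<dots> = (1 - q ^ Suc n) * qbin n (Suc i)"
        unfolding e by (simp add: algebra_simps)
      also have "\<dots> = (1 - q ^ (n - i)) * qbin n (Suc i)
          + q ^ (n - i) * ((1 - q ^ Suc i) * qbin n (Suc i))"
        unfolding e(2) by (simp add: algebra_simps)
      also have "\<dots> = (1 - q ^ (n - i)) * (qbin n (Suc i) + q ^ (n - i) * qbin n i)"
        by (simp only: Suc.IH) (simp add: algebra_simps)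
      finally show ?thesis using Suc by simp
    next
      case False
      then show ?thesis using Suc by (cases "i = n") (simp_all add: qbin_eq_0)
    qed
  qed
qed

lemma qbin_poch: "j \<le> n \<Longrightarrow> qbin n j * poch 1 j * poch 1 (n - j) = poch 1 n"
proof (induction j)
  case (Suc j)
  have "qbin n (Suc j) * poch 1 (Suc j) * poch 1 (n - Suc j)
      = ((1 - q ^ Suc j) * qbin n (Suc j)) * poch 1 j * poch 1 (n - Suc j)"
    by (simp add: poch_Suc)
  also have "\<dots> = qbin n j * poch 1 j * (poch 1 (n - Suc j) * (1 - q ^ (n - j)))"
    by (simp only: qbin_absorb) (simp add: algebra_simps)
  also have "poch 1 (n - Suc j) * (1 - q ^ (n - j)) = poch 1 (n - j)"
    using poch_Suc[of 1 "n - Suc j"] Suc.prems by (simp add: Suc_diff_Suc)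
  finally show ?case using Suc by simp
qed simp

lemma qbin_conv_poch: "j \<le> n \<Longrightarrow> qbin n j = poch 1 n / (poch 1 j * poch 1 (n - j))"
  using qbin_poch[of j n] by (simp add: field_simps)

text \<open>
The numerator of \<open>durfee_identity\<close>. As \<open>qbin\<close> vanishes outside its triangle, the sum is effectively
over \<open>j \<le> min n N\<close>, which makes it symmetric in \<open>n\<close> and \<open>N\<close>.
\<close>

definition durfee_sum :: "nat \<Rightarrow> nat \<Rightarrow> 'k \<Rightarrow> 'k" where
  "durfee_sum N n z = (\<Sum>j\<le>N. qbin n j * qbin N j * poch 1 j * q ^ (j * j) * z ^ j)"

lemma durfee_sum_commute: "durfee_sum N n z = durfee_sum n N z"
proof -
  have "durfee_sum N n z = (\<Sum>j\<le>max n N. qbin n j * qbin N j * poch 1 j * q ^ (j * j) * z ^ j)" for N n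
    unfolding durfee_sum_def by (rule sum.mono_neutral_left) (auto simp: qbin_eq_0)
  from this[of N n] this[of n N] show ?thesis by (simp add: max.commute mult.commute)
qed

text \<open>
Compare coefficients of \<open>z\<^sup>j\<^sup>+\<^sup>1\<close>: by the Pascal rule in \<open>n\<close> the coefficient changes by a multiple of
\<open>qbin n j * qbin N (j + 1)\<close>, and absorption in \<open>N\<close> turns this into a multiple of the coefficient
of \<open>z\<^sup>j\<close>. The recursion produced in this way is the one that the left-hand side of \<open>durfee_identity\<close>
satisfies.
\<close>

lemma durfee_sum_Suc:
  "durfee_sum N (Suc n) z = (1 - q ^ (n + N + 1) * z) * durfee_sum N n z + q ^ (n + 1) * z * durfee_sum N n (q * z)"
proof -
  define c where "c n j = qbin n j * qbin N j * poch 1 j * q ^ (j * j)" for n j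
  have step: "c (Suc n) (Suc j) = c n (Suc j) + c n j * (q ^ (n + 1 + j) - q ^ (n + N + 1))"
    if "j \<le> N" for j
  proof (cases "j \<le> n")
    case True
    have "q ^ (n - j) * q ^ (Suc j * Suc j) = q ^ (j * j) * q ^ (n + 1 + j)"
      using True by (simp add: ac_simps flip: power_add)
    moreover have "q ^ (n + 1 + j) * q ^ (N - j) = q ^ (n + N + 1)"
      using that by (simp flip: power_add)
    moreover have "qbin N (Suc j) * poch 1 (Suc j) = (1 - q ^ (N - j)) * qbin N j * poch 1 j"
      using qbin_absorb[of j N] by (simp add: poch_Suc mult_ac)
    ultimately have e: "q ^ (n - j) * q ^ (Suc j * Suc j) = q ^ (j * j) * q ^ (n + 1 + j)"
      "q ^ (n + N + 1) = q ^ (n + 1 + j) * q ^ (N - j)"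
      "qbin N (Suc j) * poch 1 (Suc j) = (1 - q ^ (N - j)) * (qbin N j * poch 1 j)"
      by (simp_all only: mult_ac)
    have "q ^ (n - j) * qbin n j * qbin N (Suc j) * poch 1 (Suc j) * q ^ (Suc j * Suc j)
        = qbin n j * (q ^ (n - j) * q ^ (Suc j * Suc j)) * (qbin N (Suc j) * poch 1 (Suc j))"
      by (simp only: mult_ac)
    also have "\<dots> = c n j * (q ^ (n + 1 + j) - q ^ (n + N + 1))"
      unfolding e c_def by (simp only: right_diff_distrib left_diff_distrib mult_1_left mult_ac)
    finally have "q ^ (n - j) * qbin n j * qbin N (Suc j) * poch 1 (Suc j) * q ^ (Suc j * Suc j)
        = c n j * (q ^ (n + 1 + j) - q ^ (n + N + 1))" .
    then show ?thesis by (simp add: c_def algebra_simps)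
  qed (simp add: c_def qbin_eq_0)
  have sums: "durfee_sum N n z = (\<Sum>j\<le>N. c n j * z ^ j)" for n z
    by (simp add: durfee_sum_def c_def)
  have "durfee_sum N (Suc n) z = c n 0 + (\<Sum>j<N. c (Suc n) (Suc j) * z ^ Suc j)"
    unfolding sums by (subst sum.atMost_shift) (simp add: c_def)
  also have "\<dots> = c n 0 + (\<Sum>j<N. c n (Suc j) * z ^ Suc j)
      + (\<Sum>j<N. c n j * (q ^ (n + 1 + j) - q ^ (n + N + 1)) * z ^ Suc j)"
    by (simp only: add.assoc, subst sum.distrib[symmetric], rule arg_cong[of _ _ "\<lambda>x. _ + x"],
        intro sum.cong) (simp_all add: step ring_distribs)
  also have "c n 0 + (\<Sum>j<N. c n (Suc j) * z ^ Suc j) = durfee_sum N n z"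
    unfolding sums by (subst sum.atMost_shift) simp
  also have "(\<Sum>j<N. c n j * (q ^ (n + 1 + j) - q ^ (n + N + 1)) * z ^ Suc j)
      = (\<Sum>j\<le>N. c n j * (q ^ (n + 1 + j) - q ^ (n + N + 1)) * z ^ Suc j)"
    by (rule sum.mono_neutral_left) (auto simp: not_less le_less)
  also have "\<dots> = q ^ (n + 1) * z * durfee_sum N n (q * z) - q ^ (n + N + 1) * z * durfee_sum N n z"
    unfolding sums sum_distrib_left sum_subtractf[symmetric]
    by (intro sum.cong) (simp_all add: power_add power_mult_distrib algebra_simps)
  finally show ?thesis by (simp add: algebra_simps)
qed

text \<open>
Let \<open>L n z\<close> be the left-hand side. The Pascal rule gives
\<open>L (n + 1) z = L n z + q\<^sup>n\<^sup>+\<^sup>1 z / (1 - q z) * L n (q z)\<close>, since shifting \<open>i\<close> by one multiplies \<open>q\<^bsup>i\<^sup>2\<^esup>\<close> by \<open>q\<^bsup>2i + 1\<^esup>\<close>,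
the Pascal rule contributes \<open>q\<^bsup>n - i\<^esup>\<close>, and the resulting \<open>q\<^sup>i\<close> is absorbed by replacing \<open>z\<close> by \<open>q z\<close>. The right-hand side satisfies the same recursion by
\<open>durfee_sum_Suc\<close>.
\<close>

lemma durfee_identity:
  assumes "generic z"
  shows "(\<Sum>i\<le>n. qbin n i * q ^ (i * i) * z ^ i / poch z (N + i)) = durfee_sum N n z / poch z (n + N)"
  using assms
proof (induction n arbitrary: z)
  case 0
  have "durfee_sum N 0 z = 1"
    unfolding durfee_sum_commute[of N 0] by (simp add: durfee_sum_def)
  then show ?case by simp
next
  case (Suc n)
  define L where "L n z = (\<Sum>i\<le>n. qbin n i * q ^ (i * i) * z ^ i / poch z (N + i))" for n z
  have gen: "generic (q * z)" using generic_shift_nat[OF Suc.prems, of 1] by simp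
  note nz = generic_factor[OF Suc.prems, of 1] poch_nonzero[OF gen] poch_nonzero[OF Suc.prems]
    generic_factor[OF Suc.prems]
  have "L (Suc n) z = 1 / poch z N + (\<Sum>i\<le>n. qbin n (Suc i) * q ^ (Suc i * Suc i) * z ^ Suc i / poch z (N + Suc i))
      + (\<Sum>i\<le>n. q ^ (n - i) * qbin n i * q ^ (Suc i * Suc i) * z ^ Suc i / poch z (N + Suc i))"
    unfolding L_def
    by (subst sum.atMost_Suc_shift) (simp add: sum.distrib[symmetric] ring_distribs add_divide_distrib mult.assoc)
  also have "1 / poch z N + (\<Sum>i\<le>n. qbin n (Suc i) * q ^ (Suc i * Suc i) * z ^ Suc i / poch z (N + Suc i))
      = (\<Sum>i\<le>Suc n. qbin n i * q ^ (i * i) * z ^ i / poch z (N + i))"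
    by (simp add: sum.atMost_Suc_shift del: sum.atMost_Suc)
  also have "\<dots> = L n z"
    unfolding L_def by (simp add: qbin_eq_0)
  also have "(\<Sum>i\<le>n. q ^ (n - i) * qbin n i * q ^ (Suc i * Suc i) * z ^ Suc i / poch z (N + Suc i))
      = q ^ (n + 1) * z / (1 - q * z) * L n (q * z)"
    unfolding L_def sum_distrib_left
  proof (intro sum.cong refl)
    fix i assume "i \<in> {..n}"
    then have e: "q ^ (n - i) * q ^ (Suc i * Suc i) = q ^ (n + 1) * q ^ (i * i) * q ^ i"
      by (simp add: ac_simps flip: power_add)
    have "q ^ (n - i) * qbin n i * q ^ (Suc i * Suc i) * z ^ Suc i / poch z (N + Suc i)
        = (q ^ (n - i) * q ^ (Suc i * Suc i)) * (qbin n i * z ^ Suc i / ((1 - q * z) * poch (q * z) (N + i)))"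
      by (simp add: poch_Suc_shift)
    also have "\<dots> = q ^ (n + 1) * z / (1 - q * z) * (qbin n i * q ^ (i * i) * (q * z) ^ i / poch (q * z) (N + i))"
      unfolding e by (simp add: power_mult_distrib)
    finally show "q ^ (n - i) * qbin n i * q ^ (Suc i * Suc i) * z ^ Suc i / poch z (N + Suc i)
        = q ^ (n + 1) * z / (1 - q * z) * (qbin n i * q ^ (i * i) * (q * z) ^ i / poch (q * z) (N + i))" .
  qed
  also have "L n z = durfee_sum N n z / poch z (n + N)"
    using Suc.IH[OF Suc.prems] by (simp add: L_def)
  also have "L n (q * z) = durfee_sum N n (q * z) / poch (q * z) (n + N)"
    using Suc.IH[OF gen] by (simp add: L_def)
  also have "q ^ (n + 1) * z / (1 - q * z) * (durfee_sum N n (q * z) / poch (q * z) (n + N))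
      = q ^ (n + 1) * z * durfee_sum N n (q * z) / poch z (Suc (n + N))"
    by (simp add: poch_Suc_shift)
  also have "durfee_sum N n z / poch z (n + N) = (1 - q ^ (n + N + 1) * z) * durfee_sum N n z / poch z (Suc (n + N))"
    using nz(4)[of "n + N + 1"] by (simp add: poch_Suc)
  finally show ?case
    by (simp add: L_def durfee_sum_Suc add_divide_distrib[symmetric])
qed

text \<open>
The exchange of the two parameters trades a sum of length \<open>n\<close> for one of length \<open>N\<close>; this is what
allows the entries of one sequence to be replaced by the summation variables of the closed form.
\<close>

corollary durfee_symmetric:
  assumes "generic z"
  shows "(\<Sum>i\<le>n. qbin n i * q ^ (i * i) * z ^ i / poch z (N + i))
       = (\<Sum>i\<le>N. qbin N i * q ^ (i * i) * z ^ i / poch z (n + i))"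
  by (simp only: durfee_identity[OF assms] durfee_sum_commute[of N n] add.commute[of N n])

corollary q_vandermonde:
  assumes "generic z"
  shows "(\<Sum>i\<le>n. qbin n i * q ^ (i * i) * z ^ i / poch z i) = 1 / poch z n"
  using durfee_identity[OF assms, of n 0] by (simp add: durfee_sum_def)

section \<open>Summation over a single column\<close>

lemma rq_split: "i \<le> n \<Longrightarrow> rq (k + n) (k + i) * rq (k + i) k = qbin n i / poch 1 n"
  by (simp add: rq_def qbin_conv_poch)

lemma rq_convolution:
  assumes "k \<le> n" "n \<le> M"
  shows "(\<Sum>b\<le>M. rq n b * rq b k * f b) = (\<Sum>i\<le>n-k. qbin (n-k) i * f (k + i)) / poch 1 (n-k)"
proof -
  have "(\<Sum>b\<le>M. rq n b * rq b k * f b) = (\<Sum>b\<in>{k..n}. rq n b * rq b k * f b)"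
    by (rule sum.mono_neutral_right) (use assms in \<open>auto simp: rq_def\<close>)
  also have "\<dots> = (\<Sum>i\<le>n-k. rq n (k + i) * rq (k + i) k * f (k + i))"
    by (rule sum.reindex_bij_witness[of _ "\<lambda>i. k + i" "\<lambda>b. b - k"]) (use assms in auto)
  also have "\<dots> = (\<Sum>i\<le>n-k. qbin (n-k) i * f (k + i) / poch 1 (n-k))"
    using rq_split[of _ "n - k" k] assms by (intro sum.cong) auto
  finally show ?thesis by (simp add: sum_divide_distrib)
qed

text \<open>
The variant that counts from the upper end; the two agree by the symmetry of \<open>qbin\<close>.
\<close>

lemma rq_convolution_rev:
  assumes "k \<le> n" "n \<le> M"
  shows "(\<Sum>b\<le>M. rq n b * rq b k * f b) = (\<Sum>i\<le>n-k. qbin (n-k) i * f (n - i)) / poch 1 (n-k)"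
proof -
  have "(\<Sum>i\<le>n-k. qbin (n-k) i * f (k + i)) = (\<Sum>i\<le>n-k. qbin (n-k) i * f (n - i))"
    by (rule sum.reindex_bij_witness[of _ "\<lambda>i. n - k - i" "\<lambda>i. n - k - i"])
       (use assms in \<open>auto simp: qbin_conv_poch mult.commute intro!: arg_cong[of _ _ f]\<close>)
  then show ?thesis using rq_convolution[OF assms, of f] by simp
qed

lemma rq_eq_0: "n < k \<Longrightarrow> rq n k = 0"
  by (simp add: rq_def)

lemma rq_convolution_eq_0: "n < k \<Longrightarrow> (\<Sum>b\<le>M. rq n b * rq b k * f b) = 0"
  by (rule sum.neutral) (auto simp: rq_def)

text \<open>
The \<open>q\<close>-Vandermonde identity at \<open>q\<^sup>k u\<close>. The right-hand side involves no new
summation index; this is how the indices of the old closed form disappear from the recursion.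
\<close>

lemma column_sum:
  assumes "generic u" "n \<le> M"
  shows "(\<Sum>b\<le>M. rq n b * rq b k * (q ^ (b * (b - k)) * u ^ b / poch u b)) = rq n k * u ^ k / poch u n"
proof (cases "k \<le> n")
  case True
  define N where "N = n - k"
  have n: "n = k + N" using True by (simp add: N_def)
  have "(\<Sum>b\<le>M. rq n b * rq b k * (q ^ (b * (b - k)) * u ^ b / poch u b))
      = (\<Sum>i\<le>N. qbin N i * (q ^ ((k + i) * i) * u ^ (k + i) / poch u (k + i))) / poch 1 N"
    by (simp only: rq_convolution[OF True assms(2)] N_def diff_add_inverse)
  also have "(\<Sum>i\<le>N. qbin N i * (q ^ ((k + i) * i) * u ^ (k + i) / poch u (k + i)))
      = u ^ k / poch u k * (\<Sum>i\<le>N. qbin N i * q ^ (i * i) * (q ^ k * u) ^ i / poch (q ^ k * u) i)"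
    unfolding sum_distrib_left
    by (intro sum.cong) (simp_all add: poch_add power_add power_mult_distrib power_mult ring_distribs)
  also have "\<dots> = u ^ k / poch u n"
    by (simp add: q_vandermonde[OF generic_shift_nat[OF assms(1)]] n poch_add)
  finally show ?thesis using True by (simp add: rq_def N_def)
qed (simp only: not_le rq_convolution_eq_0 rq_eq_0, simp)

text \<open>
A column \<open>c\<close> of the second colour, in the presence of an entry \<open>a\<close> of the first colour that contributes
\<open>q\<^sup>-\<^sup>a\<^sup>c\<close>. Completing the square turns the negative exponent into a shift of \<open>y\<close> by \<open>q\<^bsup>2k - a\<^esup>\<close>, and
\<open>durfee_identity\<close> with \<open>N = a - k\<close> applies. The sum over \<open>c\<close> is exchanged for one over \<open>r\<close>, from which
the denominator \<open>(qy)\<^sub>c\<close> has gone.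
\<close>

lemma column_sum_dual:
  assumes "generic y" "n \<le> M" "k \<le> a"
  shows "(\<Sum>c\<le>M. rq n c * rq c k * (q powi (int c * (int c - int a)) * y ^ c / poch y c))
       = poch 1 (a - k) / poch y n *
         (\<Sum>r\<le>M. rq n r * rq r k * (rq a r * y ^ r * q powi (int r * (int r - int a))))"
proof (cases "k \<le> n")
  case True
  define N where "N = n - k"
  define B where "B = a - k"
  \<comment> \<open>the argument for which the exponents of \<open>q\<close> below become \<open>i\<^sup>2\<close> up to a constant\<close>
  define z where "z = q powi (- int B) * (q ^ k * y)"
  have n: "n = k + N" and a: "a = k + B" using True assms by (simp_all add: N_def B_def)
  have z: "generic z" "q ^ B * z = q ^ k * y"
    unfolding z_def using q_nonzero
    by (simp_all only: generic_shift[OF generic_shift_nat[OF assms(1)]]) (simp add: power_int_minus)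
  have ex: "q powi (int (k + i) * (int (k + i) - int a)) * y ^ (k + i)
      = q powi (- int (k * B)) * y ^ k * (q ^ (i * i) * z ^ i)" for i
  proof -
    have "int (k + i) * (int (k + i) - int a)
        = - int (k * B) + int (i * i) + (- int B * int i) + int (k * i)"
      by (simp add: a algebra_simps)
    then have "q powi (int (k + i) * (int (k + i) - int a))
        = q powi (- int (k * B)) * q ^ (i * i) * (q powi (- int B)) ^ i * (q ^ k) ^ i"
      by (simp only: power_int_add q_nonzero simp_thms power_int_of_nat power_int_mult power_mult disj_not1)
    then show ?thesis
      by (simp add: z_def power_mult_distrib power_add)
  qed
  have "(\<Sum>c\<le>M. rq n c * rq c k * (q powi (int c * (int c - int a)) * y ^ c / poch y c))
     = (\<Sum>i\<le>N. qbin N i * (q powi (int (k + i) * (int (k + i) - int a)) * y ^ (k + i) / poch y (k + i))) / poch 1 N"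
    by (simp only: rq_convolution[OF True assms(2)] N_def)
  also have "(\<Sum>i\<le>N. qbin N i * (q powi (int (k + i) * (int (k + i) - int a)) * y ^ (k + i) / poch y (k + i)))
     = q powi (- int (k * B)) * y ^ k * poch z B / poch y k *
       (\<Sum>i\<le>N. qbin N i * q ^ (i * i) * z ^ i / poch z (B + i))"
    unfolding sum_distrib_left ex
    using poch_nonzero[OF assms(1)] poch_nonzero[OF z(1)] 
    by (intro sum.cong) (simp_all add: poch_add z(2))
  also have "\<dots> = q powi (- int (k * B)) * y ^ k / poch y n * durfee_sum N B z"
    using poch_nonzero[OF assms(1)] poch_nonzero[OF z(1)] 
    unfolding durfee_identity[OF z(1)] durfee_sum_commute[of B N] add.commute[of N B]
    by (simp add: n poch_add z(2))
  also have "q powi (- int (k * B)) * y ^ k / poch y n * durfee_sum N B z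
     = poch 1 B / poch y n * (\<Sum>i\<le>N. qbin N i * (rq a (k + i) * y ^ (k + i) * q powi (int (k + i) * (int (k + i) - int a))))"
    unfolding durfee_sum_def sum_distrib_left
  proof (intro sum.cong refl)
    fix i
    have "qbin B i * poch 1 i = poch 1 B * rq a (k + i)"
      by (cases "i \<le> B") (simp_all add: a rq_def qbin_conv_poch qbin_eq_0)
    then show "q powi (- int (k * B)) * y ^ k / poch y n * (qbin B i * qbin N i * poch 1 i * q ^ (i * i) * z ^ i)
        = poch 1 B / poch y n * (qbin N i * (rq a (k + i) * y ^ (k + i) * q powi (int (k + i) * (int (k + i) - int a))))"
      using ex[of i] by (simp add: mult.assoc) (simp add: mult_ac)
  qed
  finally show ?thesis
    by (simp add: rq_convolution[OF True assms(2)] N_def B_def)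
qed (simp only: not_le rq_convolution_eq_0 rq_eq_0, simp)

text \<open>
A column \<open>a\<close> of the first colour, coupled to two entries \<open>r \<ge> n\<close> of the second one. After the substitutions
\<open>a = r + i\<close> on the left and \<open>l = n - j\<close> on the right, this is \<open>durfee_symmetric\<close> at \<open>q\<^bsup>r - n\<^esup> y\<close>: the sum
over the entry \<open>a\<close> above \<open>r\<close> is exchanged for a sum over \<open>l\<close> between \<open>k\<close> and \<open>n\<close>.
\<close>

lemma column_sum_flip:
  assumes "generic y" "k \<le> n" "n \<le> r" "m \<le> M" "n \<le> M"
  shows "(\<Sum>a\<le>M. rq m a * rq a r * (q powi (int a * (int a - int r - int n)) * y ^ a / poch y (a - k)))
       = rq m r * poch 1 (n - k) *
         (\<Sum>l\<le>M. rq n l * rq l k * (y ^ (r + n - l) * q powi (int l * (int l - int r - int n)) / poch y (m - l)))"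
proof (cases "r \<le> m")
  case True
  define A where "A = m - r"
  define d where "d = r - n"
  define N where "N = n - k"
  have eqs: "n = k + N" "r = k + N + d" "m = k + N + d + A"
    using True assms by (simp_all add: A_def d_def N_def)
  \<comment> \<open>the linear terms \<open>di\<close> in the exponent of \<open>q\<close> come from this shift, and \<open>d\<close> is the same on both sides\<close>
  define z where "z = q ^ d * y"
  have z: "generic z" unfolding z_def by (rule generic_shift_nat) fact
  define C where "C = q powi (- int (r * n)) * y ^ r"
  have ex: "q powi (- int (r * n) + int (i * i) + int (d * i)) * y ^ (r + i)
      = C * (q ^ (i * i) * z ^ i)" for i
    by (simp only: power_int_add q_nonzero simp_thms power_int_of_nat C_def z_def power_mult
        power_mult_distrib power_add disj_not1) (simp add: mult_ac)
  have "(\<Sum>a\<le>M. rq m a * rq a r * (q powi (int a * (int a - int r - int n)) * y ^ a / poch y (a - k)))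
     = (\<Sum>i\<le>A. qbin A i * (q powi (int (r + i) * (int (r + i) - int r - int n)) * y ^ (r + i) / poch y (r + i - k))) / poch 1 A"
    by (simp only: rq_convolution[OF True assms(4)] A_def)
  also have "(\<Sum>i\<le>A. qbin A i * (q powi (int (r + i) * (int (r + i) - int r - int n)) * y ^ (r + i) / poch y (r + i - k)))
     = C / poch y d * (\<Sum>i\<le>A. qbin A i * q ^ (i * i) * z ^ i / poch z (N + i))"
    unfolding sum_distrib_left
  proof (intro sum.cong refl)
    fix i
    have 1: "int (r + i) * (int (r + i) - int r - int n) = - int (r * n) + int (i * i) + int (d * i)"
      by (simp add: eqs algebra_simps)
    have 2: "r + i - k = d + (N + i)" by (simp add: eqs)
    show "qbin A i * (q powi (int (r + i) * (int (r + i) - int r - int n)) * y ^ (r + i) / poch y (r + i - k))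
        = C / poch y d * (qbin A i * q ^ (i * i) * z ^ i / poch z (N + i))"
      unfolding 1 ex 2 poch_add[of y d] z_def[symmetric] by simp
  qed
  also have "\<dots> = C / poch y d * (\<Sum>j\<le>N. qbin N j * q ^ (j * j) * z ^ j / poch z (A + j))"
    by (simp only: durfee_symmetric[OF z, of A N])
  also have "\<dots> = (\<Sum>j\<le>N. qbin N j * (y ^ (r + n - (n - j)) * q powi (int (n - j) * (int (n - j) - int r - int n)) / poch y (m - (n - j))))"
    unfolding sum_distrib_left
  proof (intro sum.cong refl)
    fix j assume "j \<in> {..N}"
    then have 0: "j \<le> n" by (simp add: eqs)
    have 1: "int (n - j) * (int (n - j) - int r - int n) = - int (r * n) + int (j * j) + int (d * j)"
      using 0 by (simp add: of_nat_diff) (simp add: eqs algebra_simps)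
    have 2: "r + n - (n - j) = r + j" "m - (n - j) = d + (A + j)" using 0 by (simp_all add: eqs)
    show "C / poch y d * (qbin N j * q ^ (j * j) * z ^ j / poch z (A + j))
        = qbin N j * (y ^ (r + n - (n - j)) * q powi (int (n - j) * (int (n - j) - int r - int n)) / poch y (m - (n - j)))"
      using ex[of j] unfolding 1 2 poch_add[of y d] z_def[symmetric] by (simp add: mult.commute)
  qed
  also have "\<dots> = poch 1 (n - k) * (\<Sum>l\<le>M. rq n l * rq l k *
      (y ^ (r + n - l) * q powi (int l * (int l - int r - int n)) / poch y (m - l)))"
    by (simp only: rq_convolution_rev[OF assms(2,5)] N_def) simp
  finally show ?thesis
    using True by (simp only: rq_def[of m r] A_def if_True) simp
qed (simp only: not_le rq_convolution_eq_0 rq_eq_0, simp)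

end

section \<open>The closed form and its recursion\<close>

locale generic_pair = generic_base q for q :: "'k::field" +
  fixes y1 y2 :: 'k
  assumes generic_y1: "generic y1" and generic_y2: "generic y2"
    and generic_y12: "generic (y1 * y2)" and generic_y122: "generic (y1 * y2 ^ 2)"
begin

definition kcoef :: "nat \<Rightarrow> 'k" where
  "kcoef k = q ^ (k * k) * y2 ^ k / (poch 1 k * poch (y1 * y2 ^ 2) k)"

definition bkcoef :: "nat \<Rightarrow> nat \<Rightarrow> 'k" where
  "bkcoef b k = q ^ (b * (b - k)) * (y1 * y2) ^ b / poch (y1 * y2) b * kcoef k"

text \<open>
The double sum for \<open>F(m, n)\<close>. The summation variable \<open>b\<close> is linked to \<open>m\<close> and \<open>n\<close> only through the factors
\<open>rq n b * rq m b\<close>, and \<open>k\<close> only through \<open>poch y1 (m - k)\<close>; the remaining factors \<open>bkcoef b k\<close> stay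
fixed throughout the recursion.
\<close>

definition closed_sum :: "nat \<Rightarrow> nat \<Rightarrow> 'k" where
  "closed_sum m n = (\<Sum>b\<le>n. rq n b * rq m b * (\<Sum>k\<le>n. rq b k * bkcoef b k / poch y1 (m - k))) / poch y2 n"

text \<open>
The inner sum of \<open>closed_sum\<close> over a range \<open>M\<close> that can be shared by all terms of the recursion.
\<close>

definition zsum :: "nat \<Rightarrow> nat \<Rightarrow> nat \<Rightarrow> 'k" where
  "zsum M a b = (\<Sum>k\<le>M. rq b k * bkcoef b k / poch y1 (a - k))"

lemma closed_sum_conv_zsum:
  assumes "n \<le> M"
  shows "closed_sum m n = (\<Sum>b\<le>M. rq n b * rq m b * zsum M m b) / poch y2 n"
proof -
  have "(\<Sum>b\<le>M. rq n b * rq m b * zsum M m b) = (\<Sum>b\<le>n. rq n b * rq m b * zsum M m b)"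
    by (rule sum.mono_neutral_right) (use assms in \<open>auto simp: rq_eq_0\<close>)
  also have "\<dots> = (\<Sum>b\<le>n. rq n b * rq m b * (\<Sum>k\<le>n. rq b k * bkcoef b k / poch y1 (m - k)))"
  proof (intro sum.cong refl arg_cong[of _ _ "\<lambda>x. _ * x"])
    fix b assume "b \<in> {..n}"
    then show "zsum M m b = (\<Sum>k\<le>n. rq b k * bkcoef b k / poch y1 (m - k))"
      unfolding zsum_def
      by (intro sum.mono_neutral_right) (use assms in \<open>auto simp: rq_eq_0\<close>)
  qed
  finally show ?thesis by (simp add: closed_sum_def)
qed

lemma rq_poch [simp]: "k \<le> n \<Longrightarrow> rq n k * poch 1 (n - k) = 1"
  by (simp add: rq_def)

text \<open>
Summation over one entry \<open>c\<close> of the second colour maps the family of sums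
\<open>\<Sum>b. rq c b * rq a b * z b / (q y\<^sub>2)\<^sub>c\<close>, for arbitrary \<open>z\<close>, to itself. This is why the two entries that
are paired with the same \<open>a\<close> can be treated by applying the lemma twice.
\<close>

lemma sum_over_color2:
  assumes "n \<le> M"
  shows "(\<Sum>c\<le>M. rq n c * (q powi (int c * (int c - int a)) * y2 ^ c *
            ((\<Sum>b\<le>M. rq c b * rq a b * z b) / poch y2 c)))
       = (\<Sum>r\<le>M. rq n r * rq a r * (y2 ^ r * q powi (int r * (int r - int a)) *
            (\<Sum>b\<le>M. rq r b * z b))) / poch y2 n"
proof -
  have "(\<Sum>c\<le>M. rq n c * (q powi (int c * (int c - int a)) * y2 ^ c *
            ((\<Sum>b\<le>M. rq c b * rq a b * z b) / poch y2 c)))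
      = (\<Sum>b\<le>M. rq a b * z b *
          (\<Sum>c\<le>M. rq n c * rq c b * (q powi (int c * (int c - int a)) * y2 ^ c / poch y2 c)))"
    unfolding sum_divide_distrib sum_distrib_left by (subst sum.swap) (simp add: mult_ac)
  also have "\<dots> = (\<Sum>b\<le>M. z b * (\<Sum>r\<le>M. rq n r * rq r b * (rq a r * y2 ^ r * q powi (int r * (int r - int a)))) / poch y2 n)"
  proof (intro sum.cong refl)
    fix b
    let ?S = "\<Sum>r\<le>M. rq n r * rq r b * (rq a r * y2 ^ r * q powi (int r * (int r - int a)))"
    show "rq a b * z b * (\<Sum>c\<le>M. rq n c * rq c b * (q powi (int c * (int c - int a)) * y2 ^ c / poch y2 c))
        = z b * ?S / poch y2 n"
    proof (cases "b \<le> a")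
      case True
      have "rq a b * z b * (\<Sum>c\<le>M. rq n c * rq c b * (q powi (int c * (int c - int a)) * y2 ^ c / poch y2 c))
          = (rq a b * poch 1 (a - b)) * (z b * ?S / poch y2 n)"
        unfolding column_sum_dual[OF generic_y2 assms True] by simp
      then show ?thesis using True by simp
    next
      case False
      then have "?S = 0" by (intro sum.neutral) (auto simp: rq_def)
      then show ?thesis using False by (simp add: rq_eq_0)
    qed
  qed
  also have "\<dots> = (\<Sum>r\<le>M. rq n r * rq a r * (y2 ^ r * q powi (int r * (int r - int a)) *
            (\<Sum>b\<le>M. rq r b * z b))) / poch y2 n"
    unfolding sum_divide_distrib sum_distrib_left by (subst sum.swap) (simp add: mult_ac)
  finally show ?thesis .
qed

lemma sum_zsum:
  assumes "v \<le> M"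
  shows "(\<Sum>b\<le>M. rq v b * zsum M a b)
       = (\<Sum>k\<le>M. rq v k * ((y1 * y2) ^ k * kcoef k / poch y1 (a - k))) / poch (y1 * y2) v"
proof -
  have "(\<Sum>b\<le>M. rq v b * zsum M a b)
      = (\<Sum>k\<le>M. kcoef k / poch y1 (a - k) *
          (\<Sum>b\<le>M. rq v b * rq b k * (q ^ (b * (b - k)) * (y1 * y2) ^ b / poch (y1 * y2) b)))"
    unfolding zsum_def bkcoef_def sum_distrib_left by (subst sum.swap) (simp add: mult_ac)
  also have "\<dots> = (\<Sum>k\<le>M. rq v k * ((y1 * y2) ^ k * kcoef k / poch y1 (a - k))) / poch (y1 * y2) v"
    unfolding column_sum[OF generic_y12 assms] sum_divide_distrib by (simp add: mult_ac)
  finally show ?thesis .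
qed

lemma sum_kcoef:
  assumes "l \<le> M"
  shows "(\<Sum>k\<le>M. rq l k * ((y1 * y2) ^ k * kcoef k)) = 1 / (poch 1 l * poch (y1 * y2 ^ 2) l)"
proof -
  have "(\<Sum>k\<le>M. rq l k * ((y1 * y2) ^ k * kcoef k))
      = (\<Sum>k\<le>M. rq l k * rq k 0 * (q ^ (k * (k - 0)) * (y1 * y2 ^ 2) ^ k / poch (y1 * y2 ^ 2) k))"
    by (intro sum.cong refl)
       (simp add: kcoef_def rq_def power_mult_distrib power2_eq_square mult_ac)
  also have "\<dots> = 1 / (poch 1 l * poch (y1 * y2 ^ 2) l)"
    unfolding column_sum[OF generic_y122 assms] by (simp add: rq_def)
  finally show ?thesis .
qed

text \<open>
The remaining step, summation over the entry \<open>a\<close> of the first colour. After \<open>column_sum\<close> has removed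
the index \<open>b\<close> of the old closed form, \<open>column_sum_flip\<close> exchanges \<open>a\<close> for the new index \<open>l\<close>. Then the
sums over the old \<open>k\<close> and over the intermediate index \<open>v\<close> are again instances of \<open>column_sum\<close>, with
parameters \<open>w\<close> and \<open>u\<close>, and what is left is the term of \<open>zsum M m r\<close> with index \<open>k = l\<close>.
\<close>

lemma sum_over_color1:
  assumes "r \<le> M" "m \<le> M"
  shows "(\<Sum>a\<le>M. rq m a * rq a r * (q ^ (a * a) * y1 ^ a * (y2 ^ r * q powi (int r * (int r - int a)) *
            (\<Sum>v\<le>M. rq r v * (y2 ^ v * q powi (int v * (int v - int a)) *
              (\<Sum>b\<le>M. rq v b * zsum M a b))))))
       = rq m r * zsum M m r"
proof -
  let ?u = "y1 * y2"
  define A where "A v k = (\<Sum>a\<le>M. rq m a * rq a r *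
      (q powi (int a * (int a - int r - int v)) * y1 ^ a / poch y1 (a - k)))" for v k
  define G where "G v l = y1 ^ (r + v - l) * q powi (int l * (int l - int r - int v)) / poch y1 (m - l)" for v l
  define B where "B v = y2 ^ (r + v) * q ^ (r * r + v * v) / poch ?u v" for v
  \<comment> \<open>the factor \<open>(q)\<^sub>v\<^sub>-\<^sub>k\<close> produced by the flip cancels \<open>rq v k\<close>, which decouples \<open>k\<close> from \<open>v\<close>\<close>
  have A: "rq r v * rq v k * A v k = rq m r * rq r v * (\<Sum>l\<le>M. rq v l * rq l k * G v l)"
    if "v \<le> M" for v k
  proof (cases "k \<le> v \<and> v \<le> r")
    case True
    then have "rq r v * rq v k * A v k
        = (rq v k * poch 1 (v - k)) * (rq m r * rq r v * (\<Sum>l\<le>M. rq v l * rq l k * G v l))"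
      using that assms unfolding A_def G_def by (subst column_sum_flip[OF generic_y1]) auto
    then show ?thesis using True by simp
  next
    case False
    then consider "r < v" | "v < k" by linarith
    then show ?thesis
    proof cases
      case 2
      then have "(\<Sum>l\<le>M. rq v l * rq l k * G v l) = 0" by (rule rq_convolution_eq_0)
      then show ?thesis using 2 by (simp add: rq_eq_0)
    qed (simp add: rq_eq_0)
  qed
  have "(\<Sum>a\<le>M. rq m a * rq a r * (q ^ (a * a) * y1 ^ a * (y2 ^ r * q powi (int r * (int r - int a)) *
            (\<Sum>v\<le>M. rq r v * (y2 ^ v * q powi (int v * (int v - int a)) *
              (\<Sum>b\<le>M. rq v b * zsum M a b))))))
      = (\<Sum>a\<le>M. \<Sum>v\<le>M. \<Sum>k\<le>M. B v * (?u ^ k * kcoef k) * (rq r v * rq v k) *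
          (rq m a * rq a r * (q powi (int a * (int a - int r - int v)) * y1 ^ a / poch y1 (a - k))))"
  proof (rule sum.cong[OF refl])
    fix a
    have e: "q ^ (a * a) * (q powi (int r * (int r - int a)) * q powi (int v * (int v - int a)))
        = q ^ (r * r + v * v) * q powi (int a * (int a - int r - int v))" for v
      unfolding power_int_of_nat[symmetric] by (simp add: q_nonzero algebra_simps flip: power_int_add)
    define T where "T v = (\<Sum>b\<le>M. rq v b * zsum M a b)" for v
    show "rq m a * rq a r * (q ^ (a * a) * y1 ^ a * (y2 ^ r * q powi (int r * (int r - int a)) *
            (\<Sum>v\<le>M. rq r v * (y2 ^ v * q powi (int v * (int v - int a)) *
              (\<Sum>b\<le>M. rq v b * zsum M a b)))))
      = (\<Sum>v\<le>M. \<Sum>k\<le>M. B v * (?u ^ k * kcoef k) * (rq r v * rq v k) *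
          (rq m a * rq a r * (q powi (int a * (int a - int r - int v)) * y1 ^ a / poch y1 (a - k))))"
      unfolding T_def[symmetric] unfolding sum_distrib_left
    proof (rule sum.cong[OF refl])
      fix v assume v: "v \<in> {..M}"
      have "rq m a * rq a r * (q ^ (a * a) * y1 ^ a * (y2 ^ r * q powi (int r * (int r - int a)) *
            (rq r v * (y2 ^ v * q powi (int v * (int v - int a)) * T v))))
          = (q ^ (a * a) * (q powi (int r * (int r - int a)) * q powi (int v * (int v - int a)))) *
            (rq m a * rq a r * y1 ^ a * rq r v * (y2 ^ (r + v) / poch ?u v)) *
            (\<Sum>k\<le>M. rq v k * (?u ^ k * kcoef k / poch y1 (a - k)))"
        unfolding T_def by (subst sum_zsum) (use v in \<open>simp_all add: power_add mult_ac\<close>)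
      also have "\<dots> = (\<Sum>k\<le>M. B v * (?u ^ k * kcoef k) * (rq r v * rq v k) *
          (rq m a * rq a r * (q powi (int a * (int a - int r - int v)) * y1 ^ a / poch y1 (a - k))))"
        unfolding e sum_distrib_left B_def by (intro sum.cong refl) (simp add: mult_ac)
      finally show "rq m a * rq a r * (q ^ (a * a) * y1 ^ a * (y2 ^ r * q powi (int r * (int r - int a)) *
            (rq r v * (y2 ^ v * q powi (int v * (int v - int a)) * T v))))
          = (\<Sum>k\<le>M. B v * (?u ^ k * kcoef k) * (rq r v * rq v k) *
          (rq m a * rq a r * (q powi (int a * (int a - int r - int v)) * y1 ^ a / poch y1 (a - k))))" .
    qed
  qed
  also have "\<dots> = (\<Sum>v\<le>M. \<Sum>k\<le>M. B v * (?u ^ k * kcoef k) * (rq r v * rq v k * A v k))"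
    unfolding A_def sum_distrib_left mult.assoc by (rule sum_rotate)
  also have "\<dots> = (\<Sum>v\<le>M. \<Sum>k\<le>M. B v * (?u ^ k * kcoef k) *
      (rq m r * rq r v * (\<Sum>l\<le>M. rq v l * rq l k * G v l)))"
    by (intro sum.cong refl) (simp only: A atMost_iff)
  also have "\<dots> = (\<Sum>v\<le>M. \<Sum>l\<le>M. rq m r * B v * rq r v * rq v l * G v l *
      (\<Sum>k\<le>M. rq l k * (?u ^ k * kcoef k)))"
    unfolding sum_distrib_left by (rule sum.cong[OF refl], subst sum.swap) (simp add: mult_ac)
  also have "\<dots> = (\<Sum>v\<le>M. \<Sum>l\<le>M. rq m r * B v * rq r v * rq v l * G v l / (poch 1 l * poch (y1 * y2 ^ 2) l))"
    by (intro sum.cong refl) (simp add: sum_kcoef)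
  also have "\<dots> = (\<Sum>v\<le>M. \<Sum>l\<le>M. rq m r * (kcoef l * ?u ^ (r - l) * q ^ (r * (r - l)) / poch y1 (m - l)) *
      (rq r v * rq v l * (q ^ (v * (v - l)) * ?u ^ v / poch ?u v)))"
  proof (intro sum.cong refl)
    fix v l
    show "rq m r * B v * rq r v * rq v l * G v l / (poch 1 l * poch (y1 * y2 ^ 2) l)
      = rq m r * (kcoef l * ?u ^ (r - l) * q ^ (r * (r - l)) / poch y1 (m - l)) *
        (rq r v * rq v l * (q ^ (v * (v - l)) * ?u ^ v / poch ?u v))"
    proof (cases "l \<le> v \<and> v \<le> r")
      case True
      then obtain i j where ij: "v = l + i" "r = l + i + j" by (metis le_Suc_ex)
      have "int (l * (l + i + j) + i * l) + (int l * (int l - int r - int v)) = 0"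
        by (simp add: ij algebra_simps)
      then have e1: "q ^ (r * r + v * v) * q powi (int l * (int l - int r - int v))
          = q ^ (l * l) * q ^ (r * (r - l)) * q ^ (v * (v - l))"
        unfolding power_int_of_nat[symmetric] using q_nonzero
        by (simp add: ij algebra_simps flip: power_int_add)
      have e2: "y2 ^ (r + v) * y1 ^ (r + v - l) = y2 ^ l * (?u ^ (r - l) * ?u ^ v)"
        by (simp add: ij power_mult_distrib flip: power_add) (simp add: ac_simps power_add)
      have "rq m r * B v * rq r v * rq v l * G v l / (poch 1 l * poch (y1 * y2 ^ 2) l)
        = (q ^ (r * r + v * v) * q powi (int l * (int l - int r - int v))) * (y2 ^ (r + v) * y1 ^ (r + v - l)) *
          (rq m r * rq r v * rq v l / (poch ?u v * poch y1 (m - l) * (poch 1 l * poch (y1 * y2 ^ 2) l)))"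
        unfolding B_def G_def by (simp add: mult_ac)
      also have "\<dots> = rq m r * (kcoef l * ?u ^ (r - l) * q ^ (r * (r - l)) / poch y1 (m - l)) *
        (rq r v * rq v l * (q ^ (v * (v - l)) * ?u ^ v / poch ?u v))"
        unfolding e1 e2 kcoef_def by (simp add: mult_ac)
      finally show ?thesis .
    next
      case False
      then have "rq r v * rq v l = 0" by (auto simp: rq_def)
      then show ?thesis by auto
    qed
  qed
  also have "\<dots> = (\<Sum>l\<le>M. rq m r * (kcoef l * ?u ^ (r - l) * q ^ (r * (r - l)) / poch y1 (m - l)) *
      (rq r l * ?u ^ l / poch ?u r))"
    by (subst sum.swap) (simp only: sum_distrib_left[symmetric] column_sum[OF generic_y12 assms(1)])
  also have "\<dots> = rq m r * zsum M m r"
    unfolding zsum_def sum_distrib_left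
  proof (intro sum.cong refl)
    fix l
    show "rq m r * (kcoef l * ?u ^ (r - l) * q ^ (r * (r - l)) / poch y1 (m - l)) * (rq r l * ?u ^ l / poch ?u r)
        = rq m r * (rq r l * bkcoef r l / poch y1 (m - l))"
    proof (cases "l \<le> r")
      case True
      then have "?u ^ (r - l) * ?u ^ l = ?u ^ r" by (simp flip: power_add)
      then show ?thesis by (simp add: bkcoef_def mult_ac)
    qed (simp add: rq_eq_0)
  qed
  finally show ?thesis .
qed

text \<open>
The exponent \<open>a\<^sup>2 + b\<^sup>2 + c\<^sup>2 - a(b + c)\<close> is distributed as \<open>a\<^sup>2 + b(b - a) + c(c - a)\<close>, so that each column is
summed with its own weight.
\<close>

theorem closed_sum_recursion:
  assumes "m \<le> M" "n \<le> M"
  shows "closed_sum m n = (\<Sum>a\<le>M. \<Sum>b\<le>M. \<Sum>c\<le>M. rq m a * rq n b * rq b c *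
    (q ^ (a * a) * y1 ^ a * (q powi (int b * (int b - int a)) * y2 ^ b) *
     (q powi (int c * (int c - int a)) * y2 ^ c) * closed_sum a c))"
proof -
  \<comment> \<open>for fixed \<open>a\<close>, both entries of the second colour are summed\<close>
  have inner: "(\<Sum>b\<le>M. \<Sum>c\<le>M. rq n b * rq b c * ((q powi (int b * (int b - int a)) * y2 ^ b) *
     (q powi (int c * (int c - int a)) * y2 ^ c) * closed_sum a c))
    = (\<Sum>r\<le>M. rq n r * rq a r * (y2 ^ r * q powi (int r * (int r - int a)) *
            (\<Sum>v\<le>M. rq r v * (y2 ^ v * q powi (int v * (int v - int a)) *
              (\<Sum>b\<le>M. rq v b * zsum M a b))))) / poch y2 n" for a
  proof -
    have "(\<Sum>b\<le>M. \<Sum>c\<le>M. rq n b * rq b c * ((q powi (int b * (int b - int a)) * y2 ^ b) *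
       (q powi (int c * (int c - int a)) * y2 ^ c) * closed_sum a c))
      = (\<Sum>b\<le>M. rq n b * (q powi (int b * (int b - int a)) * y2 ^ b *
           (\<Sum>c\<le>M. rq b c * (q powi (int c * (int c - int a)) * y2 ^ c *
             ((\<Sum>d\<le>M. rq c d * rq a d * zsum M a d) / poch y2 c)))))"
      unfolding sum_distrib_left[of _ _ "{..M}"]
      by (intro sum.cong refl) (simp add: closed_sum_conv_zsum mult_ac sum_distrib_left sum_divide_distrib)
    also have "\<dots> = (\<Sum>b\<le>M. rq n b * (q powi (int b * (int b - int a)) * y2 ^ b *
       ((\<Sum>r\<le>M. rq b r * rq a r * (y2 ^ r * q powi (int r * (int r - int a)) *
            (\<Sum>d\<le>M. rq r d * zsum M a d))) / poch y2 b)))"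
      by (intro sum.cong refl) (simp only: sum_over_color2 atMost_iff)
    also have "\<dots> = (\<Sum>r\<le>M. rq n r * rq a r * (y2 ^ r * q powi (int r * (int r - int a)) *
            (\<Sum>v\<le>M. rq r v * (y2 ^ v * q powi (int v * (int v - int a)) *
              (\<Sum>b\<le>M. rq v b * zsum M a b))))) / poch y2 n"
      by (rule sum_over_color2) fact
    finally show ?thesis .
  qed
  have "(\<Sum>a\<le>M. \<Sum>b\<le>M. \<Sum>c\<le>M. rq m a * rq n b * rq b c *
    (q ^ (a * a) * y1 ^ a * (q powi (int b * (int b - int a)) * y2 ^ b) *
     (q powi (int c * (int c - int a)) * y2 ^ c) * closed_sum a c))
    = (\<Sum>a\<le>M. rq m a * (q ^ (a * a) * y1 ^ a) *
       (\<Sum>b\<le>M. \<Sum>c\<le>M. rq n b * rq b c * ((q powi (int b * (int b - int a)) * y2 ^ b) *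
     (q powi (int c * (int c - int a)) * y2 ^ c) * closed_sum a c)))"
    unfolding sum_distrib_left by (intro sum.cong refl) (simp only: mult_ac)
  also have "\<dots> = (\<Sum>r\<le>M. rq n r * (\<Sum>a\<le>M. rq m a * rq a r * (q ^ (a * a) * y1 ^ a * (y2 ^ r * q powi (int r * (int r - int a)) *
            (\<Sum>v\<le>M. rq r v * (y2 ^ v * q powi (int v * (int v - int a)) *
              (\<Sum>b\<le>M. rq v b * zsum M a b))))))) / poch y2 n"
    unfolding inner sum_divide_distrib sum_distrib_left[of _ _ "{..M}"]
    by (subst sum.swap) (simp only: mult_ac times_divide_eq_right times_divide_eq_left sum_distrib_left sum_divide_distrib)
  also have "\<dots> = (\<Sum>r\<le>M. rq n r * (rq m r * zsum M m r)) / poch y2 n"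
    using assms by (simp add: sum_over_color1)
  also have "\<dots> = closed_sum m n"
    using assms by (simp add: closed_sum_conv_zsum mult_ac)
  finally show ?thesis by simp
qed

end

section \<open>Comparison of the closed form with the finite product\<close>

context generic_pair
begin

text \<open>
The expansion of the finite product that has to be compared with \<open>closed_sum N N\<close>; it comes from
\<open>column_sum\<close> for \<open>b\<close>, with parameter \<open>u\<close>, and then for \<open>k\<close>, with parameter \<open>w\<close>.
\<close>

lemma sum_bkcoef:
  "(\<Sum>b\<le>N. rq N b * (\<Sum>k\<le>N. rq b k * bkcoef b k))
   = 1 / (poch 1 N * poch (y1 * y2) N * poch (y1 * y2 ^ 2) N)"
proof -
  have "(\<Sum>b\<le>N. rq N b * (\<Sum>k\<le>N. rq b k * bkcoef b k))
      = (\<Sum>b\<le>N. \<Sum>k\<le>N. kcoef k * (rq N b * rq b k * (q ^ (b * (b - k)) * (y1 * y2) ^ b / poch (y1 * y2) b)))"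
    unfolding bkcoef_def sum_distrib_left by (intro sum.cong refl) (simp add: mult_ac)
  also have "\<dots> = (\<Sum>k\<le>N. kcoef k * (rq N k * (y1 * y2) ^ k / poch (y1 * y2) N))"
    by (subst sum.swap) (simp only: sum_distrib_left[symmetric] column_sum[OF generic_y12 order.refl])
  also have "\<dots> = (\<Sum>k\<le>N. rq N k * ((y1 * y2) ^ k * kcoef k)) / poch (y1 * y2) N"
    unfolding sum_divide_distrib by (intro sum.cong refl) (simp add: mult_ac)
  also have "\<dots> = 1 / (poch 1 N * poch (y1 * y2) N * poch (y1 * y2 ^ 2) N)"
    unfolding sum_kcoef[OF order.refl] by simp
  finally show ?thesis .
qed

lemma closed_sum_0_0: "closed_sum 0 0 = 1"
  by (simp add: closed_sum_def rq_def bkcoef_def kcoef_def)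

end

text \<open>
The subring \<open>S\<close> plays the role of the elements without pole at \<open>q = 0\<close>, so that \<open>q\<^sup>e S\<close> measures
\<open>q\<close>-adic smallness.
\<close>

locale integral_base = generic_base q for q :: "'k::field" +
  fixes S :: "'k set"
  assumes S_1: "1 \<in> S" and S_minus: "x \<in> S \<Longrightarrow> - x \<in> S"
    and S_add: "x \<in> S \<Longrightarrow> y \<in> S \<Longrightarrow> x + y \<in> S"
    and S_mult: "x \<in> S \<Longrightarrow> y \<in> S \<Longrightarrow> x * y \<in> S"
    and S_q: "q \<in> S"
begin

lemma S_0: "0 \<in> S"
  using S_add[OF S_1 S_minus[OF S_1]] by simp

lemma S_diff: "x \<in> S \<Longrightarrow> y \<in> S \<Longrightarrow> x - y \<in> S"
  using S_add[of x "- y"] S_minus by simp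

lemma S_power: "x \<in> S \<Longrightarrow> x ^ n \<in> S"
  by (induction n) (auto intro: S_1 S_mult)

lemma S_sum: "(\<And>i. i \<in> I \<Longrightarrow> f i \<in> S) \<Longrightarrow> sum f I \<in> S"
  by (induction I rule: infinite_finite_induct) (auto intro: S_0 S_add)

lemma S_poch: "y \<in> S \<Longrightarrow> poch y n \<in> S"
  by (induction n) (auto simp: poch_Suc intro!: S_1 S_mult S_diff S_power S_q simp del: power_Suc)

lemma one_cong_mult:
  assumes "\<exists>g\<in>S. x = 1 + q ^ e * g" "\<exists>g\<in>S. y = 1 + q ^ e * g"
  shows "\<exists>g\<in>S. x * y = 1 + q ^ e * g"
proof -
  from assms obtain g h where g: "g \<in> S" "x = 1 + q ^ e * g" and h: "h \<in> S" "y = 1 + q ^ e * h"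
    by blast
  have "x * y = 1 + q ^ e * (g + h + q ^ e * (g * h))"
    by (simp add: g h algebra_simps)
  moreover have "g + h + q ^ e * (g * h) \<in> S"
    using g(1) h(1) by (intro S_add S_mult S_power S_q)
  ultimately show ?thesis by blast
qed

lemma poch_one_cong:
  assumes "y \<in> S" "e \<le> d"
  shows "\<exists>g\<in>S. poch (q ^ d * y) n = 1 + q ^ e * g"
proof (induction n)
  case 0
  then show ?case using S_0 by auto
next
  case (Suc n)
  have "d + Suc n = e + (d - e + Suc n)" using assms by simp
  then have "q ^ Suc n * (q ^ d * y) = q ^ e * (q ^ (d - e + Suc n) * y)"
    unfolding mult.assoc[symmetric] power_add[symmetric] by (simp only: add.commute)
  then have "1 - q ^ Suc n * (q ^ d * y) = 1 + q ^ e * (- (q ^ (d - e + Suc n) * y))"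
    by simp
  moreover have "- (q ^ (d - e + Suc n) * y) \<in> S"
    using assms(1) by (intro S_minus S_mult S_power S_q)
  ultimately show ?case unfolding poch_Suc by (intro one_cong_mult Suc.IH) blast
qed

lemma poch_rq_one_cong:
  assumes "b \<le> A" "A \<le> N"
  shows "\<exists>g\<in>S. poch 1 N * rq N b = 1 + q ^ (N - A) * g"
proof -
  have "poch 1 N = poch 1 (N - b) * poch (q ^ (N - b) * 1) b"
    using poch_add[of 1 "N - b" b] assms by simp
  then have "poch 1 N * rq N b = poch (q ^ (N - b) * 1) b"
    using assms by (simp add: rq_def)
  then show ?thesis using poch_one_cong[OF S_1, of "N - A" "N - b" b] assms by simp
qed

end

locale integral_pair = generic_pair q y1 y2 + integral_base q S
  for q y1 y2 :: "'k::field" and S +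
  assumes S_y1: "y1 \<in> S" and S_y2: "y2 \<in> S"
    and S_inverse: "y \<in> {1, y1, y2, y1 * y2, y1 * y2 ^ 2} \<Longrightarrow> 0 < i \<Longrightarrow> inverse (1 - q ^ i * y) \<in> S"
begin

lemma S_inverse_poch:
  assumes "y \<in> {1, y1, y2, y1 * y2, y1 * y2 ^ 2}"
  shows "inverse (poch y n) \<in> S"
proof (induction n)
  case (Suc n)
  then show ?case
    unfolding poch_Suc inverse_mult_distrib by (intro S_mult S_inverse assms) simp_all
qed (simp add: S_1)

lemma S_divide_poch:
  "x \<in> S \<Longrightarrow> y \<in> {1, y1, y2, y1 * y2, y1 * y2 ^ 2} \<Longrightarrow> x / poch y n \<in> S"
  unfolding divide_inverse by (intro S_mult S_inverse_poch)

lemma S_rq: "rq n k \<in> S"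
  unfolding rq_def by (auto intro: S_0 S_divide_poch S_1)

lemma S_kcoef: "kcoef k \<in> S"
proof -
  have "kcoef k = q ^ (k * k) * y2 ^ k / poch 1 k / poch (y1 * y2 ^ 2) k"
    by (simp add: kcoef_def)
  also have "\<dots> \<in> S" by (intro S_divide_poch S_mult S_power S_q S_y2) simp_all
  finally show ?thesis .
qed

lemma S_bkcoef: "bkcoef b k \<in> S"
  unfolding bkcoef_def
  by (intro S_mult S_kcoef S_divide_poch S_power S_q S_y1 S_y2) simp_all

lemma S_closed_sum: "closed_sum m n \<in> S"
  unfolding closed_sum_def by (intro S_divide_poch S_sum S_mult S_rq S_bkcoef) simp_all

text \<open>
The expansions of both quantities have terms that differ by the factor \<open>R b k\<close>. For \<open>b \<le> A\<close> this factor is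
congruent to \<open>1\<close> modulo \<open>q\<^sup>N\<^sup>-\<^sup>A\<close>; for \<open>b > A\<close> the term is divisible by \<open>y\<^sub>1\<^sup>A\<^sup>+\<^sup>1\<close> and does not influence the
coefficient of \<open>y\<^sub>1\<^sup>A\<close> at all.
\<close>

lemma product_minus_closed_sum:
  assumes "A \<le> N"
  shows "\<exists>g\<in>S. \<exists>h\<in>S. 1 / (poch y1 N * poch y2 N * poch (y1 * y2) N * poch (y1 * y2 ^ 2) N)
     - poch 1 N ^ 2 * closed_sum N N = q ^ (N - A) * g + y1 ^ Suc A * h"
proof -
  \<comment> \<open>the ideal generated by the two kinds of negligible terms\<close>
  define J where "J = {q ^ (N - A) * g + y1 ^ Suc A * h |g h. g \<in> S \<and> h \<in> S}"
  have J_sum: "sum f I \<in> J" if "\<And>i. i \<in> I \<Longrightarrow> f i \<in> J" for f :: "nat \<Rightarrow> 'k" and I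
    using that
  proof (induction I rule: infinite_finite_induct)
    case (insert i I)
    then have "f i \<in> J" "sum f I \<in> J" by simp_all
    then obtain g h g' h' where *: "g \<in> S" "h \<in> S" "g' \<in> S" "h' \<in> S"
      "f i = q ^ (N - A) * g + y1 ^ Suc A * h" "sum f I = q ^ (N - A) * g' + y1 ^ Suc A * h'"
      unfolding J_def mem_Collect_eq by (elim exE conjE) (rule that)
    have "f i + sum f I = q ^ (N - A) * (g + g') + y1 ^ Suc A * (h + h')"
      unfolding * by (simp add: algebra_simps)
    moreover have "g + g' \<in> S" "h + h' \<in> S" using * by (intro S_add; simp)+
    ultimately have "f i + sum f I \<in> J" unfolding J_def by blast
    then show ?case using insert.hyps by simp
  qed (use S_0 in \<open>auto simp: J_def intro!: exI[of _ 0]\<close>)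
  define T where "T b k = poch 1 N * rq N b * (rq b k * bkcoef b k) / poch y1 N / poch y2 N" for b k
  define R where "R b k = (poch 1 N * rq N b) * (poch y1 N / poch y1 (N - k))" for b k
  have TS: "T b k \<in> S" and RS: "R b k \<in> S" for b k
    unfolding T_def R_def
    by (intro S_divide_poch S_mult S_poch S_rq S_bkcoef S_1 S_y1; simp)+
  have T_cong: "T b k * (1 - R b k) \<in> J" for b k
  proof (cases "b \<le> A")
    case True
    show ?thesis
    proof (cases "k \<le> b")
      case False
      then show ?thesis using S_0 by (auto simp: T_def rq_def J_def intro!: exI[of _ 0])
    next
      case k: True
      have "poch y1 N / poch y1 (N - k) = poch (q ^ (N - k) * y1) k"
        using poch_add[of y1 "N - k" k] poch_nonzero[OF generic_y1] assms True k by simp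
      moreover have "\<exists>g\<in>S. poch (q ^ (N - k) * y1) k = 1 + q ^ (N - A) * g"
        using True k by (intro poch_one_cong S_y1) simp
      ultimately have "\<exists>g\<in>S. R b k = 1 + q ^ (N - A) * g"
        unfolding R_def by (intro one_cong_mult poch_rq_one_cong True assms) simp
      then obtain g where g: "g \<in> S" "R b k = 1 + q ^ (N - A) * g" by blast
      have "T b k * (1 - R b k) = q ^ (N - A) * (- (T b k * g)) + y1 ^ Suc A * 0"
        by (simp add: g(2))
      then show ?thesis unfolding J_def using g(1) TS S_0 by (blast intro: S_minus S_mult)
    qed
  next
    case False
    then have "y1 ^ b = y1 ^ Suc A * y1 ^ (b - Suc A)"
      by (simp flip: power_add power_Suc)
    then have "bkcoef b k = y1 ^ Suc A * (q ^ (b * (b - k)) * (y1 ^ (b - Suc A) * y2 ^ b) / poch (y1 * y2) b * kcoef k)"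
      by (simp add: bkcoef_def power_mult_distrib)
    moreover have "q ^ (b * (b - k)) * (y1 ^ (b - Suc A) * y2 ^ b) / poch (y1 * y2) b * kcoef k \<in> S"
      by (intro S_mult S_kcoef S_divide_poch S_power S_q S_y1 S_y2) simp_all
    ultimately obtain h where h: "h \<in> S" "bkcoef b k = y1 ^ Suc A * h" by blast
    have "T b k * (1 - R b k) = q ^ (N - A) * 0 +
        y1 ^ Suc A * (poch 1 N * rq N b * (rq b k * h) / poch y1 N / poch y2 N * (1 - R b k))"
      by (simp add: T_def h(2))
    moreover have "poch 1 N * rq N b * (rq b k * h) / poch y1 N / poch y2 N * (1 - R b k) \<in> S"
      by (intro S_mult S_divide_poch S_diff RS S_1 S_poch S_rq h(1)) simp_all
    ultimately show ?thesis unfolding J_def using S_0 by blast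
  qed
  have "1 / (poch y1 N * poch y2 N * poch (y1 * y2) N * poch (y1 * y2 ^ 2) N)
      = poch 1 N * (\<Sum>b\<le>N. rq N b * (\<Sum>k\<le>N. rq b k * bkcoef b k)) / poch y1 N / poch y2 N"
    unfolding sum_bkcoef by simp
  also have "\<dots> = (\<Sum>b\<le>N. \<Sum>k\<le>N. T b k)"
    unfolding T_def sum_distrib_left sum_divide_distrib by (simp add: mult_ac)
  finally have prod: "1 / (poch y1 N * poch y2 N * poch (y1 * y2) N * poch (y1 * y2 ^ 2) N)
      = (\<Sum>b\<le>N. \<Sum>k\<le>N. T b k)" .
  have "poch 1 N ^ 2 * closed_sum N N = (\<Sum>b\<le>N. \<Sum>k\<le>N. T b k * R b k)"
    unfolding closed_sum_def T_def R_def sum_distrib_left sum_divide_distrib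
    using poch_nonzero[OF generic_y1] by (simp add: power2_eq_square mult_ac)
  then have "1 / (poch y1 N * poch y2 N * poch (y1 * y2) N * poch (y1 * y2 ^ 2) N)
     - poch 1 N ^ 2 * closed_sum N N = (\<Sum>b\<le>N. \<Sum>k\<le>N. T b k * (1 - R b k))"
    unfolding prod by (simp add: sum_subtractf[symmetric] right_diff_distrib)
  also have "\<dots> \<in> J" by (intro J_sum T_cong)
  finally show ?thesis unfolding J_def by blast
qed

end

section \<open>Splitting off the first columns of the fermionic sum\<close>

text \<open>
The counterpart of \<open>rq\<close> for Laurent series in \<open>q\<close>, with the same convention for \<open>k > n\<close>.
\<close>

definition inv_qfac :: "nat \<Rightarrow> nat \<Rightarrow> 'a::field fls" where
  "inv_qfac n k = (if k \<le> n then 1 / qfac (n - k) else 0)"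

definition colors :: "nat \<Rightarrow> (nat \<Rightarrow> nat) set" where
  "colors A = {r \<in> color_seqs. seq_total r = A}"

definition weight :: "(nat \<Rightarrow> nat) \<Rightarrow> (nat \<Rightarrow> nat) \<Rightarrow> 'a::field fls" where
  "weight r1 r2 = fls_X powi int (sq_sum r1) / qfac_diffs r1 *
     (fls_X powi (int (sq_sum r2) - int (mixed_sum r1 r2)) / qfac_diffs r2)"

text \<open>
The coefficient of \<open>y\<^sub>1\<^sup>A y\<^sub>2\<^sup>B\<close> in the truncated sum \<open>F(m, n)\<close>.
\<close>

definition trunc_sum :: "nat \<Rightarrow> nat \<Rightarrow> nat \<Rightarrow> nat \<Rightarrow> 'a::field fls" where
  "trunc_sum m n A B =
     (\<Sum>r1\<in>colors A. \<Sum>r2\<in>colors B. inv_qfac m (r1 0) * inv_qfac n (r2 0) * weight r1 r2)"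

definition tail :: "(nat \<Rightarrow> nat) \<Rightarrow> nat \<Rightarrow> nat" where
  "tail r = (\<lambda>s. r (Suc s))"

lemma supp_tail: "supp r \<subseteq> insert 0 (Suc ` supp (tail r))"
proof
  fix s assume "s \<in> supp r"
  then show "s \<in> insert 0 (Suc ` supp (tail r))"
    by (cases s) (auto simp: supp_def tail_def)
qed

lemma finite_supp_tail: "finite (supp (tail r)) \<longleftrightarrow> finite (supp r)"
proof
  assume "finite (supp r)"
  moreover have "Suc ` supp (tail r) \<subseteq> supp r" by (auto simp: supp_def tail_def)
  ultimately show "finite (supp (tail r))"
    by (meson finite_imageD finite_subset inj_Suc)
qed (meson finite_imageI finite_insert finite_subset supp_tail)

lemma sum_supp_tail:
  fixes g :: "nat \<Rightarrow> nat \<Rightarrow> 'b::comm_monoid_add"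
  assumes "finite (supp r)" "\<And>s. r s = 0 \<Longrightarrow> g s (r s) = 0"
  shows "(\<Sum>s\<in>supp r. g s (r s)) = g 0 (r 0) + (\<Sum>s\<in>supp (tail r). g (Suc s) (tail r s))"
proof -
  have fin: "finite (supp (tail r))" using assms(1) by (simp add: finite_supp_tail)
  have "(\<Sum>s\<in>supp r. g s (r s)) = (\<Sum>s\<in>insert 0 (Suc ` supp (tail r)). g s (r s))"
    using supp_tail[of r] fin assms(2) by (intro sum.mono_neutral_left) (auto simp: supp_def)
  also have "\<dots> = g 0 (r 0) + (\<Sum>s\<in>supp (tail r). g (Suc s) (tail r s))"
    using fin by (subst sum.insert) (auto simp: sum.reindex tail_def)
  finally show ?thesis .
qed

lemma prod_supp_tail:
  fixes g :: "nat \<Rightarrow> 'b::comm_monoid_mult"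
  assumes "finite (supp r)" "\<And>s. r s = 0 \<Longrightarrow> g s = 1"
  shows "(\<Prod>s\<in>supp r. g s) = g 0 * (\<Prod>s\<in>supp (tail r). g (Suc s))"
proof -
  have fin: "finite (supp (tail r))" using assms(1) by (simp add: finite_supp_tail)
  have "(\<Prod>s\<in>supp r. g s) = (\<Prod>s\<in>insert 0 (Suc ` supp (tail r)). g s)"
    using supp_tail[of r] fin assms(2) by (intro prod.mono_neutral_left) (auto simp: supp_def)
  also have "\<dots> = g 0 * (\<Prod>s\<in>supp (tail r). g (Suc s))"
    using fin by (subst prod.insert) (auto simp: prod.reindex)
  finally show ?thesis .
qed

lemma seq_total_tail: "finite (supp r) \<Longrightarrow> seq_total r = r 0 + seq_total (tail r)"
  unfolding seq_total_def using sum_supp_tail[of r "\<lambda>_ x. x"] by simp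

lemma sq_sum_tail: "finite (supp r) \<Longrightarrow> sq_sum r = (r 0)\<^sup>2 + sq_sum (tail r)"
  unfolding sq_sum_def using sum_supp_tail[of r "\<lambda>_ x. x\<^sup>2"] by simp

lemma mixed_sum_tail:
  "finite (supp r1) \<Longrightarrow>
   mixed_sum r1 r2 = r1 0 * (r2 0 + r2 1) + mixed_sum (tail r1) (tail (tail r2))"
  unfolding mixed_sum_def
  using sum_supp_tail[of r1 "\<lambda>s x. x * (r2 (2 * s) + r2 (2 * s + 1))"] by (simp add: tail_def)

lemma color_seqs_tail: "r \<in> color_seqs \<Longrightarrow> tail r \<in> color_seqs"
  by (simp add: color_seqs_def finite_supp_tail) (simp add: decseq_Suc_iff tail_def)

lemma color_seqs_finite: "r \<in> color_seqs \<Longrightarrow> finite (supp r)"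
  by (simp add: color_seqs_def)

lemma color_seqs_Suc_le: "r \<in> color_seqs \<Longrightarrow> r (Suc s) \<le> r s"
  by (simp add: color_seqs_def decseq_SucD)

lemma qfac_0 [simp]: "qfac 0 = 1"
  by (simp add: qfac_def)

lemma fls_X_power_neq_1: "n > 0 \<Longrightarrow> (fls_X :: 'a::field fls) ^ n \<noteq> 1"
proof
  assume n: "n > 0" and "(fls_X :: 'a fls) ^ n = 1"
  then have "fls_nth ((fls_X :: 'a fls) ^ n) 0 = 1" by simp
  with n show False by (simp add: fls_X_power_nth)
qed

lemma qfac_nonzero [simp]: "(qfac n :: 'a::field fls) \<noteq> 0"
  unfolding qfac_def using fls_X_power_neq_1[where 'a='a] by (auto simp: Suc_le_eq)

lemma qfac_diffs_tail:
  assumes "r \<in> color_seqs"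
  shows "qfac_diffs r = qfac (r 0 - r 1) * qfac_diffs (tail r)"
  unfolding qfac_diffs_def
  using prod_supp_tail[OF color_seqs_finite[OF assms], of "\<lambda>s. qfac (r s - r (Suc s))"]
  by (simp add: tail_def)

lemma weight_tail:
  assumes r1: "r1 \<in> color_seqs" and r2: "r2 \<in> color_seqs"
  shows "weight r1 r2 = inv_qfac (r1 0) (r1 1) * inv_qfac (r2 0) (r2 1) * inv_qfac (r2 1) (r2 2) *
     (fls_X ^ (r1 0 * r1 0) * fls_X powi (int (r2 0) * (int (r2 0) - int (r1 0))) *
      fls_X powi (int (r2 1) * (int (r2 1) - int (r1 0)))) * weight (tail r1) (tail (tail r2))"
proof -
  note t2 = color_seqs_tail[OF r2]
  note fin = color_seqs_finite[OF r1] color_seqs_finite[OF r2] color_seqs_finite[OF t2]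
  have q1: "qfac_diffs r1 = qfac (r1 0 - r1 1) * (qfac_diffs (tail r1) :: 'a fls)"
    by (rule qfac_diffs_tail[OF r1])
  have q2: "qfac_diffs r2 = qfac (r2 0 - r2 1) * (qfac (r2 1 - r2 2) * (qfac_diffs (tail (tail r2)) :: 'a fls))"
    unfolding qfac_diffs_tail[OF r2] qfac_diffs_tail[OF t2] by (simp add: tail_def numeral_2_eq_2)
  have s1: "int (sq_sum r1) = int (r1 0 * r1 0) + int (sq_sum (tail r1))"
    using sq_sum_tail[OF fin(1)] by (simp add: power2_eq_square)
  have s2: "int (sq_sum r2) = int (r2 0 * r2 0) + (int (r2 1 * r2 1) + int (sq_sum (tail (tail r2))))"
    using sq_sum_tail[OF fin(2)] sq_sum_tail[OF fin(3)] by (simp add: power2_eq_square tail_def)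
  have "int (sq_sum r2) - int (mixed_sum r1 r2) = int (r2 0) * (int (r2 0) - int (r1 0))
      + int (r2 1) * (int (r2 1) - int (r1 0))
      + (int (sq_sum (tail (tail r2))) - int (mixed_sum (tail r1) (tail (tail r2))))"
    unfolding s2 mixed_sum_tail[OF fin(1)] by (simp add: algebra_simps)
  moreover have "r1 1 \<le> r1 0" "r2 1 \<le> r2 0" "r2 2 \<le> r2 1"
    using color_seqs_Suc_le[OF r1, of 0] color_seqs_Suc_le[OF r2, of 0] color_seqs_Suc_le[OF r2, of 1]
    by (simp_all add: numeral_2_eq_2)
  moreover define x :: "'a fls" where "x = fls_X"
  moreover have "x \<noteq> 0" by (simp add: x_def)
  ultimately show ?thesis
    unfolding weight_def q1 q2 s1 inv_qfac_def x_def[symmetric]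
    by (simp add: power_int_add power_int_of_nat flip: of_nat_mult) (simp add: mult_ac)
qed

text \<open>
A nonincreasing sequence with sum \<open>A\<close> has entries at most \<open>A\<close>, and its support is an initial segment of
length at most \<open>A\<close>.
\<close>

lemma finite_colors: "finite (colors A)"
proof (rule finite_subset)
  show "colors A \<subseteq> {r. \<forall>s. (s \<in> {..<A} \<longrightarrow> r s \<in> {..A}) \<and> (s \<notin> {..<A} \<longrightarrow> r s = 0)}"
  proof clarify
    fix r s assume "r \<in> colors A"
    then have dec: "decseq r" and fin: "finite (supp r)" and tot: "(\<Sum>s\<in>supp r. r s) = A"
      by (auto simp: colors_def color_seqs_def seq_total_def)
    have "r s = 0" if "s \<notin> {..<A}"
    proof (rule ccontr)
      assume s: "r s \<noteq> 0"
      have "1 \<le> r i" if "i \<le> s" for i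
        using decseqD[OF dec that] s by linarith
      then have "{..s} \<subseteq> supp r" "(\<Sum>i\<le>s. 1) \<le> (\<Sum>i\<le>s. r i)"
        by (force simp: supp_def, intro sum_mono) auto
      moreover have "(\<Sum>i\<le>s. r i) \<le> (\<Sum>i\<in>supp r. r i)"
        using fin calculation(1) by (intro sum_mono2) auto
      ultimately show False using tot that by simp
    qed
    moreover have "r s \<le> A"
    proof (cases "s \<in> supp r")
      case True
      then show ?thesis using member_le_sum[of s "supp r" r] fin tot by simp
    qed (simp add: supp_def)
    ultimately show "(s \<in> {..<A} \<longrightarrow> r s \<in> {..A}) \<and> (s \<notin> {..<A} \<longrightarrow> r s = 0)"
      by simp
  qed
  show "finite {r. \<forall>s. (s \<in> {..<A} \<longrightarrow> r s \<in> {..A}) \<and> (s \<notin> {..<A} \<longrightarrow> r s = (0::nat))}"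
    by (rule finite_set_of_finite_funs) auto
qed

lemma case_nat_in_colors:
  assumes "a \<le> A" "s \<in> colors (A - a)" "s 0 \<le> a"
  shows "case_nat a s \<in> colors A"
proof -
  have t: "tail (case_nat a s) = s" by (simp add: tail_def)
  have s: "decseq s" "finite (supp s)" "seq_total s = A - a"
    using assms by (auto simp: colors_def color_seqs_def)
  have "decseq (case_nat a s)"
    using s(1) assms(3) by (auto simp: decseq_Suc_iff split: nat.split)
  moreover have fin: "finite (supp (case_nat a s))"
    using s(2) finite_supp_tail[of "case_nat a s"] t by simp
  moreover have "seq_total (case_nat a s) = A"
    using seq_total_tail[OF fin] s(3) t assms(1) by simp
  ultimately show ?thesis by (simp add: colors_def color_seqs_def)
qed

lemma colors_tail:
  assumes "r \<in> colors A"
  shows "r 0 \<le> A" "tail r \<in> colors (A - r 0)" "tail r 0 \<le> r 0"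
  using assms seq_total_tail[of r] color_seqs_tail[of r] color_seqs_Suc_le[of r 0]
  by (auto simp: colors_def color_seqs_finite tail_def)

text \<open>
The sequences with first entry \<open>a\<close> correspond to the tails \<open>s\<close> with \<open>s 0 \<le> a\<close>. The hypothesis on \<open>g\<close>
holds for summands with a factor \<open>inv_qfac a (s 0)\<close>, and it makes this constraint automatic.
\<close>

lemma sum_colors_tail:
  fixes g :: "nat \<Rightarrow> (nat \<Rightarrow> nat) \<Rightarrow> 'b::comm_monoid_add"
  assumes "\<And>a s. a < s 0 \<Longrightarrow> g a s = 0"
  shows "(\<Sum>r\<in>colors A. g (r 0) (tail r)) = (\<Sum>a\<le>A. \<Sum>s\<in>colors (A - a). g a s)"
proof -
  have "(\<Sum>r\<in>colors A. g (r 0) (tail r))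
      = (\<Sum>(a,s)\<in>(SIGMA a:{..A}. {s \<in> colors (A - a). s 0 \<le> a}). g a s)"
  proof (rule sum.reindex_bij_witness[of _ "\<lambda>(a,s). case_nat a s" "\<lambda>r. (r 0, tail r)"], goal_cases)
    case (1 r)
    then show ?case by (auto simp: tail_def fun_eq_iff split: nat.split)
  next
    case (2 r)
    then show ?case using colors_tail[of r A] by auto
  qed (auto simp: tail_def intro: case_nat_in_colors)
  also have "\<dots> = (\<Sum>a\<le>A. \<Sum>s\<in>{s \<in> colors (A - a). s 0 \<le> a}. g a s)"
    by (rule sum.Sigma[symmetric]) (auto intro: finite_subset[OF _ finite_colors])
  also have "\<dots> = (\<Sum>a\<le>A. \<Sum>s\<in>colors (A - a). g a s)"
  proof (rule sum.cong[OF refl])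
    fix a
    show "(\<Sum>s\<in>{s \<in> colors (A - a). s 0 \<le> a}. g a s) = (\<Sum>s\<in>colors (A - a). g a s)"
      by (rule sum.mono_neutral_left) (auto simp: finite_colors not_le assms)
  qed
  finally show ?thesis .
qed

lemma sum_colors_tail2:
  fixes g :: "nat \<Rightarrow> nat \<Rightarrow> (nat \<Rightarrow> nat) \<Rightarrow> 'b::comm_monoid_add"
  assumes "\<And>b c s. b < c \<Longrightarrow> g b c s = 0" "\<And>b c s. c < s 0 \<Longrightarrow> g b c s = 0"
  shows "(\<Sum>r\<in>colors B. g (r 0) (r 1) (tail (tail r)))
       = (\<Sum>b\<le>B. \<Sum>c\<le>B - b. \<Sum>s\<in>colors (B - (b + c)). g b c s)"
proof -
  have "(\<Sum>r\<in>colors B. g (r 0) (r 1) (tail (tail r))) = (\<Sum>r\<in>colors B. g (r 0) (tail r 0) (tail (tail r)))"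
    by (simp add: tail_def)
  also have "\<dots> = (\<Sum>b\<le>B. \<Sum>s\<in>colors (B - b). g b (s 0) (tail s))"
    by (rule sum_colors_tail) (rule assms(1))
  also have "\<dots> = (\<Sum>b\<le>B. \<Sum>c\<le>B - b. \<Sum>s\<in>colors (B - b - c). g b c s)"
    by (intro sum.cong refl sum_colors_tail) (rule assms(2))
  finally show ?thesis by simp
qed

text \<open>
One entry of \<open>r\<^sub>1\<close> and two entries of \<open>r\<^sub>2\<close> are removed together, because \<open>mixed_sum\<close> pairs them; the factors
\<open>1 / (q)\<^bsub>a - a'\<^esub>\<close> and \<open>1 / (q)\<^bsub>c - c'\<^esub>\<close> from \<open>qfac_diffs\<close>, in which \<open>a'\<close> and \<open>c'\<close> are the first entries
of the two tails, become the truncation factors of the smaller sum.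
\<close>

lemma trunc_sum_recursion:
  assumes "A \<le> M" "B \<le> M"
  shows "trunc_sum m n A B = (\<Sum>a\<le>M. \<Sum>b\<le>M. \<Sum>c\<le>M. inv_qfac m a * inv_qfac n b * inv_qfac b c *
     (fls_X ^ (a * a) * fls_X powi (int b * (int b - int a)) * fls_X powi (int c * (int c - int a))) *
     (if a \<le> A \<and> b + c \<le> B then trunc_sum a c (A - a) (B - (b + c)) else 0))"
proof -
  define K where "K a b c = inv_qfac m a * inv_qfac n b * inv_qfac b c *
     (fls_X ^ (a * a) * fls_X powi (int b * (int b - int a)) *
      fls_X powi (int c * (int c - int a)) :: 'a fls)" for a b c
  define H where "H a s b c t = K a b c * (inv_qfac a (s 0) * inv_qfac c (t 0) * weight s t)" for a b c s t
  have "trunc_sum m n A B = (\<Sum>r1\<in>colors A. \<Sum>r2\<in>colors B. H (r1 0) (tail r1) (r2 0) (r2 1) (tail (tail r2)))"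
    unfolding trunc_sum_def H_def K_def
    by (intro sum.cong refl, subst weight_tail)
       (auto simp: colors_def tail_def numeral_2_eq_2)
  also have "\<dots> = (\<Sum>r1\<in>colors A. \<Sum>b\<le>B. \<Sum>c\<le>B - b. \<Sum>t\<in>colors (B - (b + c)). H (r1 0) (tail r1) b c t)"
    by (intro sum.cong refl sum_colors_tail2) (simp_all add: H_def K_def inv_qfac_def)
  also have "\<dots> = (\<Sum>a\<le>A. \<Sum>s\<in>colors (A - a). \<Sum>b\<le>B. \<Sum>c\<le>B - b. \<Sum>t\<in>colors (B - (b + c)). H a s b c t)"
    by (intro sum_colors_tail) (simp add: H_def inv_qfac_def)
  also have "\<dots> = (\<Sum>a\<le>A. \<Sum>b\<le>B. \<Sum>c\<le>B - b. K a b c * trunc_sum a c (A - a) (B - (b + c)))"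
    unfolding trunc_sum_def sum_distrib_left H_def
    by (rule sum.cong[OF refl], subst sum.swap, rule sum.cong[OF refl], subst sum.swap) simp
  also have "\<dots> = (\<Sum>a\<le>A. \<Sum>b\<le>B. \<Sum>c\<le>M. K a b c *
      (if b + c \<le> B then trunc_sum a c (A - a) (B - (b + c)) else 0))"
    using assms by (intro sum.cong refl sum.mono_neutral_cong_left) auto
  also have "\<dots> = (\<Sum>a\<le>A. \<Sum>b\<le>M. \<Sum>c\<le>M. K a b c *
      (if b + c \<le> B then trunc_sum a c (A - a) (B - (b + c)) else 0))"
    using assms by (intro sum.cong refl sum.mono_neutral_left) auto
  also have "\<dots> = (\<Sum>a\<le>M. \<Sum>b\<le>M. \<Sum>c\<le>M. K a b c *
      (if a \<le> A \<and> b + c \<le> B then trunc_sum a c (A - a) (B - (b + c)) else 0))"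
    using assms by (intro sum.mono_neutral_cong_left) auto
  finally show ?thesis by (simp only: K_def)
qed

lemma trunc_sum_0_0: "trunc_sum 0 0 A B = (if A = 0 \<and> B = 0 then 1 else 0)"
proof -
  define zero_seq :: "nat \<Rightarrow> nat" where "zero_seq = (\<lambda>_. 0)"
  have zero: "r = zero_seq" if "r \<in> colors A" "r 0 = 0" for r A
  proof
    fix s
    have "r s \<le> r 0" using that(1) by (auto simp: colors_def color_seqs_def decseq_def)
    then show "r s = zero_seq s" using that(2) by (simp add: zero_seq_def)
  qed
  have z: "supp zero_seq = {}" "zero_seq \<in> colors A \<longleftrightarrow> A = 0" for A
    by (auto simp: zero_seq_def supp_def colors_def color_seqs_def seq_total_def decseq_def)
  define f where "f r1 r2 = (inv_qfac 0 (r1 0) * inv_qfac 0 (r2 0) * weight r1 r2 :: 'a fls)" for r1 r2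
  have f: "f r1 r2 = 0" if "r1 0 \<noteq> 0 \<or> r2 0 \<noteq> 0" for r1 r2
    using that by (auto simp: f_def inv_qfac_def)
  have "trunc_sum 0 0 A B = (\<Sum>r1\<in>colors A. \<Sum>r2\<in>colors B. f r1 r2)"
    by (simp only: trunc_sum_def f_def)
  also have "\<dots> = (\<Sum>r1\<in>colors A. \<Sum>r2\<in>colors B \<inter> {zero_seq}. f r1 r2)"
    by (intro sum.cong refl sum.mono_neutral_right) (use f zero in \<open>auto simp: finite_colors\<close>)
  also have "\<dots> = (\<Sum>r1\<in>colors A \<inter> {zero_seq}. \<Sum>r2\<in>colors B \<inter> {zero_seq}. f r1 r2)"
    by (intro sum.mono_neutral_right) (use f zero in \<open>auto simp: finite_colors intro!: sum.neutral\<close>)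
  also have "\<dots> = (if A = 0 \<and> B = 0 then f zero_seq zero_seq else 0)"
    using z(2)[of A] z(2)[of B] by (cases "A = 0"; cases "B = 0") auto
  also have "f zero_seq zero_seq = 1"
    by (simp add: f_def inv_qfac_def weight_def z sq_sum_def mixed_sum_def qfac_diffs_def) (simp add: zero_seq_def)
  finally show ?thesis .
qed

section \<open>Integral Laurent series and \<open>q\<close>-adic limits\<close>

definition integral_fls :: "'a::field fls set" where
  "integral_fls = range fps_to_fls"

lemma integral_0: "0 \<in> integral_fls" and integral_1: "1 \<in> integral_fls" and integral_X: "fls_X \<in> integral_fls"
  unfolding integral_fls_def
  by (metis rangeI fps_zero_to_fls, metis rangeI fps_one_to_fls, metis rangeI fps_X_to_fls)

lemma integral_add: "x \<in> integral_fls \<Longrightarrow> y \<in> integral_fls \<Longrightarrow> x + y \<in> integral_fls"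
  unfolding integral_fls_def by (metis (no_types, lifting) imageE rangeI fps_to_fls_plus)

lemma integral_mult: "x \<in> integral_fls \<Longrightarrow> y \<in> integral_fls \<Longrightarrow> x * y \<in> integral_fls"
  unfolding integral_fls_def by (metis (no_types, lifting) imageE rangeI fls_times_fps_to_fls)

lemma integral_minus: "x \<in> integral_fls \<Longrightarrow> - x \<in> integral_fls"
  unfolding integral_fls_def by (metis (no_types, lifting) imageE rangeI fps_to_fls_uminus)

lemma integral_sum: "(\<And>i. i \<in> I \<Longrightarrow> f i \<in> integral_fls) \<Longrightarrow> sum f I \<in> integral_fls"
  by (induction I rule: infinite_finite_induct) (auto intro: integral_0 integral_add)

lemma integral_inverse_one_minus_X_power:
  assumes "0 < i"
  shows "inverse (1 - fls_X ^ i) \<in> (integral_fls :: 'a::field fls set)"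
proof -
  have "subdegree (1 - fps_X ^ i :: 'a fps) = 0"
    by (rule subdegreeI) (use assms in auto)
  then have "inverse (fps_to_fls (1 - fps_X ^ i)) = fps_to_fls (inverse (1 - fps_X ^ i :: 'a fps))"
    by (rule fls_inverse_fps_to_fls)
  then show ?thesis
    by (auto simp: integral_fls_def fps_to_fls_power)
qed

text \<open>
Multiplication by a fixed Laurent series therefore preserves convergence to \<open>0\<close>, at the cost of a
shift in the exponent of \<open>q\<close>.
\<close>

lemma X_power_mult_integral:
  fixes c :: "'a::field fls"
  obtains d where "fls_X ^ d * c \<in> integral_fls"
proof -
  define d where "d = nat (- fls_subdegree c)"
  have "0 \<le> fls_subdegree (fls_X ^ d * c)"
    by (cases "c = 0") (simp_all add: d_def)
  then obtain p where "fls_X ^ d * c = fls_shift 0 (fps_to_fls p)"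
    using fls_as_fps'[of "fls_X ^ d * c" 0] by auto
  then have "fls_X ^ d * c \<in> integral_fls" by (simp add: integral_fls_def)
  then show ?thesis by (rule that)
qed

interpretation fls_base: generic_base "fls_X :: 'a::field fls"
  by standard (use fls_X_power_neq_1 in auto)

interpretation fls_integral: integral_base "fls_X :: 'a::field fls" integral_fls
  by standard (auto intro: integral_1 integral_X integral_add integral_mult integral_minus)

lemma fls_poch_1: "fls_base.poch 1 n = qfac n"
  by (simp add: fls_base.poch_def qfac_def)

lemma fls_rq: "fls_base.rq = inv_qfac"
  by (simp add: fun_eq_iff fls_base.rq_def inv_qfac_def fls_poch_1)

lemma tendsto_flsI:
  fixes f :: "nat \<Rightarrow> 'a::field fls"
  assumes "\<And>N. K \<le> N \<Longrightarrow> \<exists>g\<in>integral_fls. f N - l = fls_X ^ (N - K) * g"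
  shows "f \<longlonglongrightarrow> l"
proof (rule tendstoI)
  fix e :: real assume "e > 0"
  then obtain n where n: "inverse (2 ^ n) < e"
    using real_arch_pow_inv[of e "1/2"] by (auto simp: power_one_over inverse_eq_divide)
  have "dist (f N) l < e" if "K + n \<le> N" for N
  proof (cases "f N = l")
    case False
    have "K \<le> N" using that by simp
    then obtain g where g: "g \<in> integral_fls" "f N - l = fls_X ^ (N - K) * g"
      using assms by blast
    from g(1) obtain p where p: "g = fps_to_fls p" by (auto simp: integral_fls_def)
    have "g \<noteq> 0" using False g by auto
    then have deg: "int n \<le> fls_subdegree (f N - l)"
      using that fls_subdegree_fls_to_fps_gt0[of p] by (simp add: g(2) p)
    then have "dist (f N) l = inverse (2 ^ nat (fls_subdegree (f N - l)))"
      using False by (simp add: dist_fls_def)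
    also have "\<dots> \<le> inverse (2 ^ n)"
      using deg by (intro le_imp_inverse_le power_increasing) auto
    finally show ?thesis using n by simp
  qed (use \<open>e > 0\<close> in simp)
  then show "\<forall>\<^sub>F N in sequentially. dist (f N) l < e"
    by (auto simp: eventually_sequentially)
qed

section \<open>Formal series inside their fraction field\<close>

lemma coef_0 [simp]: "coef 0 = 0" and coef_1 [simp]: "coef 1 = 1"
  and coef_diff: "coef (a - b) = coef a - coef b"
  and coef_mult: "coef (a * b) = coef a * coef b"
  and coef_power: "coef (a ^ n) = coef a ^ n"
  by (simp_all add: coef_def)

lemma coef_nth: "(coef c * f) $ a $ b = c * f $ a $ b"
  by (simp add: coef_def)

lemma monomial_nth:
  "(Y1 ^ i * Y2 ^ j * f) $ a $ b = (if i \<le> a \<and> j \<le> b then f $ (a - i) $ (b - j) else 0)"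
proof -
  have "(Y1 ^ i * Y2 ^ j * f) $ a $ b = (fps_X ^ i * (fps_const (fps_X ^ j) * f)) $ a $ b"
    by (simp only: Y1_def Y2_def mult.assoc fps_const_power)
  also have "\<dots> = (if i \<le> a \<and> j \<le> b then f $ (a - i) $ (b - j) else 0)"
    by (simp add: fps_X_power_mult_nth del: fps_const_power)
  finally show ?thesis .
qed

lemma coef_eq_iff: "coef a = coef b \<longleftrightarrow> a = b"
  by (metis coef_def fps_nth_fps_const)

definition embed :: "'a::field fls \<Rightarrow> 'a fls fps fps fract" where
  "embed c = to_fract (coef c)"

lemma embed_0 [simp]: "embed 0 = 0" and embed_1 [simp]: "embed 1 = 1"
  and embed_diff: "embed (a - b) = embed a - embed b"
  and embed_mult: "embed (a * b) = embed a * embed b"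
  by (simp_all add: embed_def coef_diff coef_mult)

lemma embed_power: "embed (a ^ n) = embed a ^ n"
  by (induction n) (simp_all add: embed_mult)

lemma embed_inverse: "embed (inverse a) = inverse (embed a)"
proof (cases "a = 0")
  case False
  then have "embed a * embed (inverse a) = 1" by (simp flip: embed_mult)
  then show ?thesis by (metis inverse_unique)
qed simp

lemma embed_divide: "embed (a / b) = embed a / embed b"
  by (simp add: divide_inverse embed_mult embed_inverse)

lemma embed_powi: "embed (a powi n) = embed a powi n"
  by (simp add: power_int_def embed_power embed_inverse)

lemma to_fract_power: "to_fract (f ^ n) = to_fract f ^ n"
  by (induction n) simp_all

lemma to_fract_sum: "to_fract (sum f I) = (\<Sum>i\<in>I. to_fract (f i))"
  by (induction I rule: infinite_finite_induct) simp_all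

lemma to_fract_inverse_nested:
  fixes f :: "'a::field fls fps fps"
  assumes "f $ 0 $ 0 \<noteq> 0"
  shows "to_fract (inverse f) = inverse (to_fract f)"
proof -
  have "to_fract f * to_fract (inverse f) = 1"
    using mult_inverse_nested[OF assms] by (metis to_fract_mult to_fract_1)
  then show ?thesis by (metis inverse_unique)
qed

abbreviation "fq \<equiv> embed fls_X"
abbreviation "fy1 \<equiv> to_fract Y1"
abbreviation "fy2 \<equiv> to_fract Y2"

text \<open>
The results on \<open>q\<close>-identities are now available in the fraction field of the ring of formal series.
The elements \<open>y\<^sub>1\<close>, \<open>y\<^sub>2\<close>, \<open>u\<close>, \<open>w\<close> are generic there because they have no constant term.
\<close>

interpretation nested: generic_base "fq :: 'a::field fls fps fps fract"
proof
  show "embed fls_X \<noteq> (0 :: 'a fls fps fps fract)"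
    by (simp add: embed_def) (simp add: coef_def)
  show "embed fls_X ^ n \<noteq> (1 :: 'a fls fps fps fract)" if "n > 0" for n
  proof -
    have "embed (fls_X ^ n) \<noteq> (embed 1 :: 'a fls fps fps fract)"
      using fls_X_power_neq_1[OF that] by (simp only: embed_def to_fract_eq_iff coef_eq_iff)
    then show ?thesis by (simp add: embed_power)
  qed
qed

lemma nested_generic:
  fixes y :: "'a::field fls fps fps"
  assumes "y $ 0 $ 0 = 0"
  shows "nested.generic (to_fract y)"
  unfolding nested.generic_def
proof
  fix i :: int
  have "coef (fls_X powi i) * y \<noteq> 1"
  proof
    assume "coef (fls_X powi i) * y = 1"
    then have "(coef (fls_X powi i) * y) $ 0 $ 0 = 1" by simp
    then show False using assms by (simp add: coef_nth)
  qed
  then show "fq powi i * to_fract y \<noteq> 1"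
    by (metis embed_def embed_powi to_fract_1 to_fract_eq_iff to_fract_mult)
qed

interpretation nested: generic_pair "fq :: 'a::field fls fps fps fract" fy1 fy2
proof
  show "nested.generic (fy1 :: 'a fls fps fps fract)" by (rule nested_generic) (simp add: Y1_def)
  show "nested.generic (fy2 :: 'a fls fps fps fract)" by (rule nested_generic) (simp add: Y2_def)
  show "nested.generic (fy1 * fy2 :: 'a fls fps fps fract)"
    unfolding to_fract_mult[symmetric] by (rule nested_generic) (simp add: Y1_def)
  show "nested.generic (fy1 * fy2 ^ 2 :: 'a fls fps fps fract)"
    unfolding to_fract_mult[symmetric] to_fract_power[symmetric]
    by (rule nested_generic) (simp add: Y1_def)
qed

definition integral_series :: "'a::field fls fps fps set" where
  "integral_series = {f. \<forall>a b. f $ a $ b \<in> integral_fls}"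

lemma nth_mult_nested:
  "(f * g) $ a $ b = (\<Sum>(i,j)\<in>{0..a} \<times> {0..b}. f $ i $ j * g $ (a - i) $ (b - j))"
  by (simp add: fps_mult_nth fps_sum_nth sum.cartesian_product)

text \<open>
The equation \<open>f * inverse f = 1\<close> expresses each coefficient of the inverse by coefficients of lower total
degree, divided by the constant term of \<open>f\<close>.
\<close>

lemma integral_series_inverse:
  assumes f: "f \<in> integral_series" and unit: "inverse (f $ 0 $ 0) \<in> integral_fls" "f $ 0 $ 0 \<noteq> 0"
  shows "inverse f \<in> integral_series"
proof -
  define g where "g = inverse f"
  have fg: "f * g = 1" unfolding g_def by (rule mult_inverse_nested) fact
  have "g $ a $ b \<in> integral_fls" for a b
  proof (induction "a + b" arbitrary: a b rule: less_induct)
    case less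
    define R where "R = (\<Sum>(i,j)\<in>{0..a} \<times> {0..b} - {(0,0)}. f $ i $ j * g $ (a - i) $ (b - j))"
    have eq: "(1 :: 'a fls fps fps) $ a $ b = f $ 0 $ 0 * g $ a $ b + R"
      unfolding fg[symmetric] nth_mult_nested R_def
      by (subst sum.remove[of _ "(0,0)"]) auto
    have "R \<in> integral_fls"
      unfolding R_def
    proof (rule integral_sum)
      fix ij assume "ij \<in> {0..a} \<times> {0..b} - {(0,0)}"
      then obtain i j where ij: "ij = (i,j)" "i \<le> a" "j \<le> b" "0 < i + j" by (cases ij) auto
      then have "g $ (a - i) $ (b - j) \<in> integral_fls" by (intro less) auto
      then show "(case ij of (i,j) \<Rightarrow> f $ i $ j * g $ (a - i) $ (b - j)) \<in> integral_fls"
        using f by (auto simp: ij integral_series_def intro: integral_mult)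
    qed
    moreover have "(1 :: 'a fls fps fps) $ a $ b \<in> integral_fls"
      by (simp add: integral_0 integral_1)
    ultimately have "(1 :: 'a fls fps fps) $ a $ b + - R \<in> integral_fls"
      by (intro integral_add integral_minus)
    moreover have "f $ 0 $ 0 * g $ a $ b = (1 :: 'a fls fps fps) $ a $ b + - R"
      unfolding eq by simp
    ultimately have "f $ 0 $ 0 * g $ a $ b \<in> integral_fls" by (simp only:)
    from integral_mult[OF unit(1) this] show ?case
      using unit(2) by (simp add: mult.assoc[symmetric])
  qed
  then show ?thesis by (simp add: integral_series_def g_def)
qed

lemma integral_series_1: "1 \<in> integral_series"
  by (simp add: integral_series_def integral_0 integral_1)

lemma integral_series_add: "f \<in> integral_series \<Longrightarrow> g \<in> integral_series \<Longrightarrow> f + g \<in> integral_series"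
  by (simp add: integral_series_def integral_add)

lemma integral_series_minus: "f \<in> integral_series \<Longrightarrow> - f \<in> integral_series"
  by (simp add: integral_series_def integral_minus)

lemma integral_series_mult: "f \<in> integral_series \<Longrightarrow> g \<in> integral_series \<Longrightarrow> f * g \<in> integral_series"
  unfolding integral_series_def mem_Collect_eq nth_mult_nested
  by (auto intro!: integral_sum integral_mult)

lemma integral_series_coef: "c \<in> integral_fls \<Longrightarrow> coef c \<in> integral_series"
  by (auto simp: integral_series_def coef_def integral_0)

lemma integral_series_Y: "Y1 \<in> integral_series" "Y2 \<in> integral_series"
  by (auto simp: integral_series_def Y1_def Y2_def fps_X_def integral_0 integral_1)

interpretation nested: integral_pair "fq :: 'a::field fls fps fps fract" fy1 fy2 "to_fract ` integral_series"
proof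
  show "1 \<in> to_fract ` (integral_series :: 'a fls fps fps set)"
    using integral_series_1 by (metis imageI to_fract_1)
  show "- x \<in> to_fract ` integral_series" if "x \<in> to_fract ` integral_series" for x :: "'a fls fps fps fract"
    using that integral_series_minus by (metis (no_types, lifting) image_iff to_fract_uminus)
  show "x + y \<in> to_fract ` integral_series" if "x \<in> to_fract ` integral_series" "y \<in> to_fract ` integral_series"
    for x y :: "'a fls fps fps fract"
    using that integral_series_add by (metis (no_types, lifting) image_iff to_fract_add)
  show "x * y \<in> to_fract ` integral_series" if "x \<in> to_fract ` integral_series" "y \<in> to_fract ` integral_series"
    for x y :: "'a fls fps fps fract"
    using that integral_series_mult by (metis (no_types, lifting) image_iff to_fract_mult)
  show "fq \<in> to_fract ` (integral_series :: 'a fls fps fps set)"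
    unfolding embed_def by (intro imageI integral_series_coef integral_X)
  show "fy1 \<in> to_fract ` (integral_series :: 'a fls fps fps set)" "fy2 \<in> to_fract ` (integral_series :: 'a fls fps fps set)"
    by (intro imageI integral_series_Y)+
  fix y :: "'a fls fps fps fract" and i :: nat
  assume y: "y \<in> {1, fy1, fy2, fy1 * fy2, fy1 * fy2 ^ 2}" and i: "0 < i"
  obtain z :: "'a fls fps fps" where z: "y = to_fract z" "z \<in> integral_series" "z $ 0 $ 0 = 0 \<or> z = 1"
  proof -
    have "y \<in> to_fract ` {1, Y1, Y2, Y1 * Y2, Y1 * Y2 ^ 2}"
      using y by (simp add: to_fract_power)
    moreover have "z \<in> integral_series \<and> (z $ 0 $ 0 = 0 \<or> z = 1)"
      if "z \<in> {1, Y1, Y2, Y1 * Y2, Y1 * Y2 ^ 2 :: 'a fls fps fps}" for z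
    proof
      show "z \<in> integral_series"
        using that by (auto simp: power2_eq_square intro!: integral_series_1 integral_series_mult integral_series_Y)
      show "z $ 0 $ 0 = 0 \<or> z = 1"
        using that by (auto simp: Y1_def Y2_def)
    qed
    ultimately show ?thesis using that by blast
  qed
  define f where "f = 1 - coef (fls_X ^ i) * z"
  have X: "fls_X ^ i \<in> integral_fls"
    by (rule fls_integral.S_power) (rule integral_X)
  have f: "f \<in> integral_series"
    unfolding f_def diff_conv_add_uminus
    by (intro integral_series_add integral_series_minus integral_series_mult integral_series_coef integral_series_1 z X)
  have f0: "f $ 0 $ 0 = 1 - fls_X ^ i * z $ 0 $ 0"
    by (simp add: f_def coef_def)
  have "inverse (f $ 0 $ 0) \<in> integral_fls \<and> f $ 0 $ 0 \<noteq> 0"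
    using z(3)
  proof
    assume "z = 1"
    moreover have "1 - fls_X ^ i \<noteq> (0 :: 'a fls)"
      using fls_X_power_neq_1[OF i, where 'a='a] by (metis eq_iff_diff_eq_0)
    ultimately show ?thesis
      using integral_inverse_one_minus_X_power[OF i, where 'a='a] by (simp add: f0)
  qed (simp add: f0 integral_1)
  then have "inverse f \<in> integral_series" "to_fract (inverse f) = inverse (to_fract f)"
    using integral_series_inverse[OF f] to_fract_inverse_nested by auto
  moreover have "to_fract f = 1 - fq ^ i * y"
    by (simp add: f_def z(1) embed_def coef_power to_fract_power)
  ultimately show "inverse (1 - fq ^ i * y) \<in> to_fract ` integral_series"
    by (metis imageI)
qed

lemma nested_poch_1: "nested.poch 1 n = embed (qfac n)"
proof (induction n)
  case (Suc n)
  then show ?case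
    by (simp add: nested.poch_Suc qfac_def embed_mult embed_diff embed_power)
qed simp

lemma nested_rq: "nested.rq n k = embed (inv_qfac n k)"
  by (simp add: nested.rq_def inv_qfac_def nested_poch_1 embed_divide)

text \<open>
The closed form is a fraction all of whose denominators are units of the ring of formal series, so it
comes from a series; \<open>S_closed_sum\<close> provides the witness.
\<close>

definition closed_series :: "nat \<Rightarrow> nat \<Rightarrow> 'a::field fls fps fps" where
  "closed_series m n = (SOME f. to_fract f = nested.closed_sum m n)"

lemma to_fract_closed_series: "to_fract (closed_series m n) = nested.closed_sum m n"
proof -
  have "\<exists>f. to_fract f = nested.closed_sum m n"
    using nested.S_closed_sum[of m n] by (metis imageE)
  then show ?thesis unfolding closed_series_def by (rule someI_ex)
qed

lemma closed_series_nth_recursion: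
  assumes "m \<le> M" "n \<le> M"
  shows "closed_series m n $ A $ B = (\<Sum>a\<le>M. \<Sum>b\<le>M. \<Sum>c\<le>M. inv_qfac m a * inv_qfac n b * inv_qfac b c *
     (fls_X ^ (a * a) * fls_X powi (int b * (int b - int a)) * fls_X powi (int c * (int c - int a))) *
     (if a \<le> A \<and> b + c \<le> B then closed_series a c $ (A - a) $ (B - (b + c)) else 0))"
proof -
  define K where "K a b c = inv_qfac m a * inv_qfac n b * inv_qfac b c *
     (fls_X ^ (a * a) * fls_X powi (int b * (int b - int a)) *
      fls_X powi (int c * (int c - int a)) :: 'a fls)" for a b c
  have "to_fract (closed_series m n) = to_fract (\<Sum>a\<le>M. \<Sum>b\<le>M. \<Sum>c\<le>M.
      coef (K a b c) * (Y1 ^ a * Y2 ^ (b + c) * closed_series a c))"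
    unfolding to_fract_closed_series nested.closed_sum_recursion[OF assms] to_fract_sum to_fract_mult
      embed_def[symmetric] K_def embed_mult embed_power embed_powi nested_rq to_fract_power power_add
    by (simp only: mult_ac)
  then have "closed_series m n = (\<Sum>a\<le>M. \<Sum>b\<le>M. \<Sum>c\<le>M.
      coef (K a b c) * (Y1 ^ a * Y2 ^ (b + c) * closed_series a c))"
    by (simp only: to_fract_eq_iff)
  then have "closed_series m n $ A $ B = (\<Sum>a\<le>M. \<Sum>b\<le>M. \<Sum>c\<le>M.
      coef (K a b c) * (Y1 ^ a * Y2 ^ (b + c) * closed_series a c)) $ A $ B"
    by simp
  then show ?thesis
    unfolding fps_sum_nth coef_nth monomial_nth K_def .
qed

lemma closed_series_0_0: "closed_series 0 0 = 1"
  using to_fract_closed_series[of 0 0] by (simp add: nested.closed_sum_0_0 flip: to_fract_1)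

text \<open>
Both sides satisfy the same recursion, in which every term other than the one with \<open>a = b = c = 0\<close> refers to
a coefficient of smaller total degree. In that one exceptional term both sides are explicitly known.
\<close>

theorem closed_series_nth_eq_trunc_sum: "closed_series m n $ A $ B = trunc_sum m n A B"
proof (induction "A + B" arbitrary: m n A B rule: less_induct)
  case less
  define M where "M = m + n + A + B"
  have M: "m \<le> M" "n \<le> M" "A \<le> M" "B \<le> M" by (simp_all add: M_def)
  show ?case
    unfolding closed_series_nth_recursion[OF M(1,2)] trunc_sum_recursion[OF M(3,4)]
  proof (intro sum.cong refl)
    fix a b c
    show "inv_qfac m a * inv_qfac n b * inv_qfac b c *
     (fls_X ^ (a * a) * fls_X powi (int b * (int b - int a)) * fls_X powi (int c * (int c - int a))) *
     (if a \<le> A \<and> b + c \<le> B then closed_series a c $ (A - a) $ (B - (b + c)) else 0)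
     = inv_qfac m a * inv_qfac n b * inv_qfac b c *
     (fls_X ^ (a * a) * fls_X powi (int b * (int b - int a)) * fls_X powi (int c * (int c - int a))) *
     (if a \<le> A \<and> b + c \<le> B then trunc_sum a c (A - a) (B - (b + c)) else 0 :: 'a fls)"
    proof (cases "a \<le> A \<and> b + c \<le> B \<and> 0 < a + b + c")
      case True
      then show ?thesis using less[of "A - a" "B - (b + c)" a c] by auto
    next
      case False
      then show ?thesis by (cases "A = 0") (auto simp: closed_series_0_0 trunc_sum_0_0)
    qed
  qed
qed

section \<open>The product and the sum as limits\<close>

lemma to_fract_product:
  fixes N :: nat
  defines "y1 \<equiv> to_fract Y1 :: 'a::field fls fps fps fract" and "y2 \<equiv> to_fract Y2"
  shows "to_fract (\<Prod>m=1..N. inverse (1 - coef (fls_X ^ m) * Y1) *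
           inverse (1 - coef (fls_X ^ m) * Y2) *
           inverse (1 - coef (fls_X ^ m) * Y1 * Y2) *
           inverse (1 - coef (fls_X ^ m) * Y1 * Y2 ^ 2))
     = 1 / (nested.poch y1 N * nested.poch y2 N * nested.poch (y1 * y2) N * nested.poch (y1 * y2 ^ 2) N)"
proof (induction N)
  case (Suc N)
  have inv: "to_fract (inverse (1 - coef (fls_X ^ m) * z)) = inverse (1 - fq ^ m * to_fract z)"
    if "z $ 0 $ 0 = 0" for m and z :: "'a fls fps fps"
    using that by (subst to_fract_inverse_nested)
      (simp_all add: embed_def coef_power to_fract_power)
  have Y0: "(Y1 :: 'a fls fps fps) $ 0 $ 0 = 0" "(Y2 :: 'a fls fps fps) $ 0 $ 0 = 0"
    by (simp_all add: Y1_def Y2_def)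
  have "to_fract (inverse (1 - coef (fls_X ^ Suc N) * Y1) *
           inverse (1 - coef (fls_X ^ Suc N) * Y2) *
           inverse (1 - coef (fls_X ^ Suc N) * Y1 * Y2) *
           inverse (1 - coef (fls_X ^ Suc N) * Y1 * Y2 ^ 2))
      = inverse (1 - fq ^ Suc N * y1) * inverse (1 - fq ^ Suc N * y2) *
        inverse (1 - fq ^ Suc N * (y1 * y2)) * inverse (1 - fq ^ Suc N * (y1 * y2 ^ 2))"
    unfolding mult.assoc[of "coef _"] to_fract_mult y1_def y2_def
    by (subst (1 2 3 4) inv)
       (simp_all add: Y0 to_fract_power del: power_Suc)
  then show ?case
    using Suc.IH
    by (simp add: nested.poch_Suc divide_inverse mult_ac del: power_Suc)
qed simp

lemma common_denominator:
  assumes "finite I"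
  shows "\<exists>D. \<forall>i\<in>I. fls_X ^ D * c i \<in> (integral_fls :: 'a::field fls set)"
  using assms
proof induction
  case (insert i I)
  then obtain D where D: "\<And>j. j \<in> I \<Longrightarrow> fls_X ^ D * c j \<in> integral_fls" by blast
  obtain d where d: "fls_X ^ d * c i \<in> integral_fls" by (rule X_power_mult_integral)
  have X: "fls_X ^ n \<in> (integral_fls :: 'a fls set)" for n
    by (rule fls_integral.S_power) (rule integral_X)
  have "fls_X ^ (d + D) * c j \<in> integral_fls" if "j \<in> insert i I" for j
  proof (cases "j = i")
    case True
    then show ?thesis
      using integral_mult[OF X[of D] d] by (simp only: power_add mult_ac)
  next
    case False
    then show ?thesis
      using that integral_mult[OF X[of d] D[of j]] by (simp add: power_add mult_ac)
  qed
  then show ?case by blast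
qed simp

text \<open>
The common value of both sides of the identity.
\<close>

definition fermionic :: "'a::field fls fps fps" where
  "fermionic = Abs_fps (\<lambda>A. Abs_fps (\<lambda>B. \<Sum>r1\<in>colors A. \<Sum>r2\<in>colors B. weight r1 r2))"

lemma fermionic_nth: "fermionic $ A $ B = (\<Sum>r1\<in>colors A. \<Sum>r2\<in>colors B. weight r1 r2)"
  by (simp add: fermionic_def)

lemma colors_0_le: "r \<in> colors A \<Longrightarrow> r 0 \<le> A"
  by (rule colors_tail)

text \<open>
Multiplied by \<open>(q)\<^sub>N\<^sup>2\<close>, the truncation factors of \<open>F(N, N)\<close> are congruent to \<open>1\<close> modulo a power of \<open>q\<close> that
grows with \<open>N\<close>, uniformly over the finitely many sequences with totals \<open>A\<close> and \<open>B\<close>.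
\<close>

lemma trunc_sum_limit:
  "\<exists>K. \<forall>N\<ge>K. \<exists>g\<in>integral_fls.
    qfac N ^ 2 * trunc_sum N N A B - fermionic $ A $ B = (fls_X :: 'a::field fls) ^ (N - K) * g"
proof -
  \<comment> \<open>one power of \<open>q\<close> that makes all the finitely many weights integral\<close>
  obtain D where D: "\<forall>(r1,r2)\<in>colors A \<times> colors B. fls_X ^ D * (weight r1 r2 :: 'a fls) \<in> integral_fls"
    using common_denominator[of "colors A \<times> colors B" "\<lambda>(r1,r2). weight r1 r2 :: 'a fls"]
    by (auto simp: finite_colors split_beta)
  show ?thesis
  proof (intro exI allI impI)
    fix N assume N: "A + B + D \<le> N"
    define e where "e = N - (A + B)"
    have ratio: "\<exists>g\<in>integral_fls. (qfac N * inv_qfac N b :: 'a fls) = 1 + fls_X ^ e * g" if "b \<le> A + B" for b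
      using fls_integral.poch_rq_one_cong[of b "A + B" N] that N
      by (simp add: fls_poch_1 fls_rq e_def)
    have step: "\<exists>g\<in>integral_fls. (qfac N * inv_qfac N (r1 0)) * (qfac N * inv_qfac N (r2 0)) * weight r1 r2 - weight r1 r2
        = (fls_X :: 'a fls) ^ (N - (A + B + D)) * g"
      if r: "r1 \<in> colors A" "r2 \<in> colors B" for r1 r2
    proof -
      have "r1 0 \<le> A + B" "r2 0 \<le> A + B"
        using r[THEN colors_0_le] by simp_all
      then obtain g where g: "g \<in> integral_fls"
        "(qfac N * inv_qfac N (r1 0)) * (qfac N * inv_qfac N (r2 0)) = (1 + fls_X ^ e * g :: 'a fls)"
        using fls_integral.one_cong_mult[OF ratio ratio] by blast
      have "e = N - (A + B + D) + D" using N by (simp add: e_def)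
      then have "(qfac N * inv_qfac N (r1 0)) * (qfac N * inv_qfac N (r2 0)) * weight r1 r2 - weight r1 r2
          = fls_X ^ (N - (A + B + D)) * (g * (fls_X ^ D * weight r1 r2))"
        unfolding g(2) by (simp add: algebra_simps power_add)
      moreover have "fls_X ^ D * weight r1 r2 \<in> (integral_fls :: 'a fls set)"
        using D r by auto
      then have "g * (fls_X ^ D * weight r1 r2) \<in> integral_fls"
        by (rule integral_mult[OF g(1)])
      ultimately show ?thesis by blast
    qed
    then obtain G where G: "\<And>r1 r2. r1 \<in> colors A \<Longrightarrow> r2 \<in> colors B \<Longrightarrow> G r1 r2 \<in> integral_fls"
      "\<And>r1 r2. r1 \<in> colors A \<Longrightarrow> r2 \<in> colors B \<Longrightarrow>
        (qfac N * inv_qfac N (r1 0)) * (qfac N * inv_qfac N (r2 0)) * weight r1 r2 - weight r1 r2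
        = (fls_X :: 'a fls) ^ (N - (A + B + D)) * G r1 r2"
      by metis
    have "qfac N ^ 2 * trunc_sum N N A B - fermionic $ A $ B
        = (\<Sum>r1\<in>colors A. \<Sum>r2\<in>colors B.
            (qfac N * inv_qfac N (r1 0)) * (qfac N * inv_qfac N (r2 0)) * weight r1 r2 - (weight r1 r2 :: 'a fls))"
      unfolding trunc_sum_def fermionic_nth sum_distrib_left sum_subtractf
      by (simp add: power2_eq_square mult_ac)
    also have "\<dots> = fls_X ^ (N - (A + B + D)) * (\<Sum>r1\<in>colors A. \<Sum>r2\<in>colors B. G r1 r2)"
      unfolding sum_distrib_left by (intro sum.cong refl G(2))
    finally show "\<exists>g\<in>integral_fls. qfac N ^ 2 * trunc_sum N N A B - fermionic $ A $ B
        = (fls_X :: 'a fls) ^ (N - (A + B + D)) * g"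
      using G(1) by (intro bexI[of _ "\<Sum>r1\<in>colors A. \<Sum>r2\<in>colors B. G r1 r2"] integral_sum)
  qed
qed

text \<open>
The finite product is close to \<open>(q)\<^sub>N\<^sup>2 F(N, N)\<close> by \<open>product_minus_closed_sum\<close>, and that is close to the
fermionic sum by \<open>trunc_sum_limit\<close>.
\<close>

lemma has_formal_prod_fermionic:
  "has_formal_prod
      (\<lambda>m. inverse (1 - coef (fls_X ^ m) * Y1) *
           inverse (1 - coef (fls_X ^ m) * Y2) *
           inverse (1 - coef (fls_X ^ m) * Y1 * Y2) *
           inverse (1 - coef (fls_X ^ m) * Y1 * Y2 ^ 2)) (fermionic :: 'a::field fls fps fps)"
  unfolding has_formal_prod_def
proof (intro allI)
  fix A B
  define P :: "nat \<Rightarrow> 'a fls fps fps" where "P N = (\<Prod>m=1..N. inverse (1 - coef (fls_X ^ m) * Y1) *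
           inverse (1 - coef (fls_X ^ m) * Y2) *
           inverse (1 - coef (fls_X ^ m) * Y1 * Y2) *
           inverse (1 - coef (fls_X ^ m) * Y1 * Y2 ^ 2))" for N
  have P: "\<exists>g\<in>integral_fls. P N $ A $ B - qfac N ^ 2 * trunc_sum N N A B = fls_X ^ (N - A) * g"
    if N: "A \<le> N" for N
  proof -
    obtain g h :: "'a fls fps fps" where gh: "g \<in> integral_series"
      "to_fract (P N) - nested.poch 1 N ^ 2 * nested.closed_sum N N
        = fq ^ (N - A) * to_fract g + fy1 ^ Suc A * to_fract h"
      using nested.product_minus_closed_sum[OF N, where 'a='a] unfolding P_def to_fract_product by blast
    have "to_fract (P N - coef (qfac N) ^ 2 * closed_series N N)
        = to_fract (coef (fls_X ^ (N - A)) * g + Y1 ^ Suc A * h)"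
      using gh(2) unfolding nested_poch_1 to_fract_closed_series[symmetric]
      by (simp only: embed_def to_fract_mult to_fract_power to_fract_add to_fract_diff coef_power)
    then have eq: "P N - coef (qfac N ^ 2) * closed_series N N
        = coef (fls_X ^ (N - A)) * g + Y1 ^ Suc A * Y2 ^ 0 * h"
      by (simp only: to_fract_eq_iff coef_power) simp
    have "(P N - coef (qfac N ^ 2) * closed_series N N) $ A $ B = fls_X ^ (N - A) * g $ A $ B"
      unfolding eq fps_add_nth coef_nth monomial_nth by simp
    then have "P N $ A $ B - qfac N ^ 2 * trunc_sum N N A B = fls_X ^ (N - A) * g $ A $ B"
      by (simp only: fps_sub_nth coef_nth closed_series_nth_eq_trunc_sum)
    then show ?thesis using gh(1) by (auto simp: integral_series_def)
  qed
  obtain K where K: "\<And>N. K \<le> N \<Longrightarrow> \<exists>g\<in>integral_fls.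
    qfac N ^ 2 * trunc_sum N N A B - fermionic $ A $ B = (fls_X :: 'a fls) ^ (N - K) * g"
    using trunc_sum_limit[of A B] by blast
  have X: "fls_X ^ n \<in> (integral_fls :: 'a fls set)" for n
    by (rule fls_integral.S_power) (rule integral_X)
  have "(\<lambda>N. P N $ A $ B) \<longlonglongrightarrow> fermionic $ A $ B"
  proof (rule tendsto_flsI)
    fix N assume N: "A + K \<le> N"
    obtain g where g: "g \<in> integral_fls" "P N $ A $ B - qfac N ^ 2 * trunc_sum N N A B = fls_X ^ (N - A) * g"
      using P[of N] N by auto
    obtain h where h: "h \<in> integral_fls"
      "qfac N ^ 2 * trunc_sum N N A B - fermionic $ A $ B = (fls_X :: 'a fls) ^ (N - K) * h"
      using K[of N] N by auto
    have e: "N - A = N - (A + K) + K" "N - K = N - (A + K) + A" using N by simp_all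
    have "P N $ A $ B - fermionic $ A $ B = fls_X ^ (N - A) * g + fls_X ^ (N - K) * h"
      unfolding g(2)[symmetric] h(2)[symmetric] by simp
    also have "\<dots> = fls_X ^ (N - (A + K)) * (fls_X ^ K * g + fls_X ^ A * h)"
      unfolding e power_add by (simp add: algebra_simps)
    finally show "\<exists>g\<in>integral_fls. P N $ A $ B - fermionic $ A $ B = fls_X ^ (N - (A + K)) * g"
      using g(1) h(1) X by (blast intro: integral_add integral_mult)
  qed
  then show "(\<lambda>N. (\<Prod>m=1..N. inverse (1 - coef (fls_X ^ m) * Y1) *
           inverse (1 - coef (fls_X ^ m) * Y2) *
           inverse (1 - coef (fls_X ^ m) * Y1 * Y2) *
           inverse (1 - coef (fls_X ^ m) * Y1 * Y2 ^ 2)) $ A $ B)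
    \<longlonglongrightarrow> (fermionic :: 'a fls fps fps) $ A $ B"
    by (simp only: P_def)
qed

text \<open>
Only the finitely many pairs of sequences with totals \<open>A\<close> and \<open>B\<close> contribute to the coefficient of
\<open>y\<^sub>1\<^sup>A y\<^sub>2\<^sup>B\<close>.
\<close>

lemma has_formal_sum_fermionic:
  "has_formal_sum
      (\<lambda>(r1, r2).
         coef (fls_X powi int (sq_sum r1) / qfac_diffs r1 *
               (fls_X powi (int (sq_sum r2) - int (mixed_sum r1 r2)) / qfac_diffs r2)) *
         Y1 ^ seq_total r1 * Y2 ^ seq_total r2)
      (color_seqs \<times> color_seqs) (fermionic :: 'a::field fls fps fps)"
  unfolding has_formal_sum_def weight_def[symmetric]
proof (intro allI)
  fix A B
  define t :: "(nat \<Rightarrow> nat) \<times> (nat \<Rightarrow> nat) \<Rightarrow> 'a fls fps fps" where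
    "t = (\<lambda>(r1, r2). coef (weight r1 r2) * Y1 ^ seq_total r1 * Y2 ^ seq_total r2)"
  have t: "t (r1, r2) $ A $ B = (if seq_total r1 = A \<and> seq_total r2 = B then weight r1 r2 else 0)" for r1 r2
  proof -
    have "t (r1, r2) = Y1 ^ seq_total r1 * Y2 ^ seq_total r2 * coef (weight r1 r2)"
      by (simp add: t_def mult_ac)
    then show ?thesis
      by (simp only: monomial_nth) (auto simp: coef_def)
  qed
  let ?I = "{i \<in> color_seqs \<times> color_seqs. t i $ A $ B \<noteq> 0}"
  have sub: "?I \<subseteq> colors A \<times> colors B"
    by (auto simp: t colors_def split: if_splits)
  have fin: "finite (colors A \<times> colors B)"
    by (simp add: finite_colors)
  have "fermionic $ A $ B = (\<Sum>(r1,r2)\<in>colors A \<times> colors B. weight r1 r2)"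
    by (simp add: fermionic_nth sum.cartesian_product)
  also have "\<dots> = (\<Sum>i\<in>colors A \<times> colors B. t i $ A $ B)"
  proof (rule sum.cong[OF refl])
    fix i assume "i \<in> colors A \<times> colors B"
    then obtain r1 r2 where "i = (r1, r2)" "seq_total r1 = A" "seq_total r2 = B"
      by (auto simp: colors_def)
    then show "(case i of (r1, r2) \<Rightarrow> weight r1 r2) = t i $ A $ B"
      by (simp add: t)
  qed
  also have "\<dots> = (\<Sum>i\<in>?I. t i $ A $ B)"
    using sub by (intro sum.mono_neutral_right fin) (auto simp: colors_def)
  finally show "finite ?I \<and> fermionic $ A $ B = (\<Sum>i\<in>?I. t i $ A $ B)"
    using finite_subset[OF sub fin] by simp
qed

theorem theorem5:
  shows "\<exists>F :: 'a::field fls fps fps.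
    has_formal_prod
      (\<lambda>m. inverse (1 - coef (fls_X ^ m) * Y1) *
           inverse (1 - coef (fls_X ^ m) * Y2) *
           inverse (1 - coef (fls_X ^ m) * Y1 * Y2) *
           inverse (1 - coef (fls_X ^ m) * Y1 * Y2 ^ 2)) F \<and>
    has_formal_sum
      (\<lambda>(r1, r2).
         coef (fls_X powi int (sq_sum r1) / qfac_diffs r1 *
               (fls_X powi (int (sq_sum r2) - int (mixed_sum r1 r2)) / qfac_diffs r2)) *
         Y1 ^ seq_total r1 * Y2 ^ seq_total r2)
      (color_seqs \<times> color_seqs) F"
  using has_formal_prod_fermionic has_formal_sum_fermionic by blast

end
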